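(* There is a polynomial-time algorithm for solving the following problem: given a set $X\subseteq A^m$ of feasible evaluations (listed explicitly), determine whether or not $X$ admits a binary (i.e., $2$-ary) non-dictatorial aggregator and, if it does, produce one.
   Context: Setting: $m\ge 1$ is the number of issues, $A$ is a finite set of positions with $|A|\ge 2$, and $X\subseteq A^m$ is a finite set of "feasible evaluations". $X_j\subseteq A$ denotes the $j$-th projection of $X$, and it is assumed throughout that $|X_j|\ge 2$ for all $j\in\{1,\ldots,m\}$. The sets $A$, $m$ and $X$ are part of the input; $X$ is given explicitly by listing all its elements, and running time is measured in the size of this listing. For $n\ge 2$, an $n$-ary aggregator for $X$ is an $m$-tuple $F=(f_1,\ldots,f_m)$ of functions $f_j:X_j^n\to X_j$ such that: (1) (collective rationality) for all $x^1,\ldots,x^n\in X$, with $x^i=(x^i_1,\ldots,x^i_m)$ and $x_j=(x_j^1,\ldots,x_j^n)$, we have $(f_1(x_1),\ldots,f_m(x_m))\in X$; (2) (conservativity) $f_j(a_1,\ldots,a_n)\in\{a_1,\ldots,a_n\}$ for all $j$ and all $a_1,\ldots,a_n\in X_j$. $F$ is dictatorial if there is $d\in\{1,\ldots,n\}$ such that every $f_j$ is the projection $\mathrm{pr}_d^n$ onto the $d$-th coordinate; otherwise it is non-dictatorial. Producing an aggregator means outputting the tables of its component functions. *)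

theory Defs
  imports Main "HOL-Library.FuncSet" "HOL-Library.NList"
    "HOL-Computational_Algebra.Polynomial"
begin

section \<open>Aggregators\<close>

text \<open>An evaluation is a list of length \<open>m\<close>; issues are numbered from \<open>0\<close> to \<open>m - 1\<close>.\<close>

definition proj :: "'a list set \<Rightarrow> nat \<Rightarrow> 'a set" where
  "proj X j = (\<lambda>x. x ! j) ` X"

definition feasible_evaluations :: "'a set \<Rightarrow> nat \<Rightarrow> 'a list set \<Rightarrow> bool" where
  "feasible_evaluations A m X \<longleftrightarrow>
     m \<ge> 1 \<and> finite A \<and> card A \<ge> 2 \<and> X \<subseteq> nlists m A \<and> (\<forall>j<m. card (proj X j) \<ge> 2)"

text \<open>The component functions of an aggregator take their \<open>n\<close> arguments as a list. They are total
  functions in HOL; only their values on the \<open>n\<close>-tuples over the projection of \<open>X\<close> are relevant.\<close>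

definition aggregator :: "nat \<Rightarrow> nat \<Rightarrow> 'a list set \<Rightarrow> (nat \<Rightarrow> 'a list \<Rightarrow> 'a) \<Rightarrow> bool" where
  "aggregator n m X F \<longleftrightarrow>
     (\<forall>j<m. F j \<in> nlists n (proj X j) \<rightarrow> proj X j) \<and>
     (\<forall>xs \<in> nlists n X. map (\<lambda>j. F j (map (\<lambda>x. x ! j) xs)) [0..<m] \<in> X) \<and>
     (\<forall>j<m. \<forall>as \<in> nlists n (proj X j). F j as \<in> set as)"

definition dictatorial :: "nat \<Rightarrow> nat \<Rightarrow> 'a list set \<Rightarrow> (nat \<Rightarrow> 'a list \<Rightarrow> 'a) \<Rightarrow> bool" where
  "dictatorial n m X F \<longleftrightarrow> (\<exists>d<n. \<forall>j<m. \<forall>as \<in> nlists n (proj X j). F j as = as ! d)"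

definition non_dictatorial_aggregator ::
    "nat \<Rightarrow> nat \<Rightarrow> 'a list set \<Rightarrow> (nat \<Rightarrow> 'a list \<Rightarrow> 'a) \<Rightarrow> bool" where
  "non_dictatorial_aggregator n m X F \<longleftrightarrow> aggregator n m X F \<and> \<not> dictatorial n m X F"

definition listing :: "'a list \<Rightarrow> 'a set \<Rightarrow> bool" where
  "listing xs S \<longleftrightarrow> distinct xs \<and> set xs = S"

definition tables :: "nat \<Rightarrow> nat \<Rightarrow> 'a list set \<Rightarrow> (nat \<Rightarrow> 'a list \<Rightarrow> 'a) \<Rightarrow>
    ('a list \<times> 'a) list list \<Rightarrow> bool" where
  "tables n m X F Ts \<longleftrightarrow> length Ts = m \<and>
     (\<forall>j<m. listing (Ts ! j) ((\<lambda>as. (as, F j as)) ` nlists n (proj X j)))"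


section \<open>Model of computation\<close>

text \<open>
  Algorithms are programs of a deterministic imperative language over binary trees (the WHILE
  language of N. D. Jones, Computability and Complexity from a Programming Perspective).
  Each program has finitely many variables. Evaluating an expression, in an assignment or as a
  condition, costs one plus the number of inner nodes of the resulting tree. So a program pays for
  every cell that it stores or outputs, no data can be shared for free, and running times agree
  with those of multi-tape Turing machines up to a polynomial.
\<close>

datatype tree = Leaf | Node tree tree

primrec cells :: "tree \<Rightarrow> nat" where
  "cells Leaf = 0"
| "cells (Node l r) = Suc (cells l + cells r)"

primrec hd_tree :: "tree \<Rightarrow> tree" where
  "hd_tree Leaf = Leaf"
| "hd_tree (Node l r) = l"

primrec tl_tree :: "tree \<Rightarrow> tree" where
  "tl_tree Leaf = Leaf"
| "tl_tree (Node l r) = r"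

datatype exp = Var nat | Nil_exp | Cons_exp exp exp | Hd_exp exp | Tl_exp exp

type_synonym state = "nat \<Rightarrow> tree"

primrec eval_exp :: "exp \<Rightarrow> state \<Rightarrow> tree" where
  "eval_exp (Var x) s = s x"
| "eval_exp Nil_exp s = Leaf"
| "eval_exp (Cons_exp a b) s = Node (eval_exp a s) (eval_exp b s)"
| "eval_exp (Hd_exp a) s = hd_tree (eval_exp a s)"
| "eval_exp (Tl_exp a) s = tl_tree (eval_exp a s)"

definition cost_exp :: "exp \<Rightarrow> state \<Rightarrow> nat" where
  "cost_exp e s = Suc (cells (eval_exp e s))"

datatype com = Skip | Assign nat exp | Seq com com | Cond exp com com | While exp com

text \<open>\<open>exec c s t s'\<close>: started in \<open>s\<close>, the program \<open>c\<close> halts in \<open>s'\<close> after time \<open>t\<close>.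
  A condition holds iff its value is not \<open>Leaf\<close>.\<close>

inductive exec :: "com \<Rightarrow> state \<Rightarrow> nat \<Rightarrow> state \<Rightarrow> bool" where
  Skip: "exec Skip s 1 s"
| Assign: "exec (Assign x e) s (cost_exp e s) (s(x := eval_exp e s))"
| Seq: "exec c1 s t1 s' \<Longrightarrow> exec c2 s' t2 s'' \<Longrightarrow> exec (Seq c1 c2) s (t1 + t2) s''"
| CondTrue: "eval_exp e s \<noteq> Leaf \<Longrightarrow> exec c1 s t s' \<Longrightarrow>
    exec (Cond e c1 c2) s (cost_exp e s + t) s'"
| CondFalse: "eval_exp e s = Leaf \<Longrightarrow> exec c2 s t s' \<Longrightarrow>
    exec (Cond e c1 c2) s (cost_exp e s + t) s'"
| WhileFalse: "eval_exp e s = Leaf \<Longrightarrow> exec (While e c) s (cost_exp e s) s"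
| WhileTrue: "eval_exp e s \<noteq> Leaf \<Longrightarrow> exec c s t1 s' \<Longrightarrow> exec (While e c) s' t2 s'' \<Longrightarrow>
    exec (While e c) s (cost_exp e s + t1 + t2) s''"

inductive_cases exec_SkipE: "exec Skip s t s'"
inductive_cases exec_AssignE: "exec (Assign x e) s t s'"
inductive_cases exec_SeqE: "exec (Seq c1 c2) s t s'"
inductive_cases exec_CondE: "exec (Cond e c1 c2) s t s'"
inductive_cases exec_WhileE: "exec (While e c) s t s'"

lemma exec_deterministic:
  assumes "exec c s t s'" and "exec c s u s''"
  shows "t = u \<and> s' = s''"
  using assms
proof (induction arbitrary: u s'' rule: exec.induct)
  case (Seq c1 s t1 s' c2 t2 s'')
  from Seq.prems show ?case
    by (rule exec_SeqE) (metis Seq.IH)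
next
  case (CondTrue e s c1 t s' c2)
  from CondTrue.prems show ?case
    by (rule exec_CondE) (use CondTrue.hyps CondTrue.IH in metis)+
next
  case (CondFalse e s c2 t s' c1)
  from CondFalse.prems show ?case
    by (rule exec_CondE) (use CondFalse.hyps CondFalse.IH in metis)+
next
  case (WhileFalse e s c)
  from WhileFalse.prems show ?case
    by (rule exec_WhileE) (use WhileFalse.hyps in metis)+
next
  case (WhileTrue e s c t1 s' t2 s'')
  from WhileTrue.prems show ?case
    by (rule exec_WhileE) (use WhileTrue.hyps WhileTrue.IH in metis)+
qed (auto elim: exec_SkipE exec_AssignE)

definition computes_in_time :: "com \<Rightarrow> tree \<Rightarrow> nat \<Rightarrow> tree \<Rightarrow> bool" where
  "computes_in_time c input t result \<longleftrightarrow>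
     (\<exists>s. exec c ((\<lambda>_. Leaf)(0 := input)) t s \<and> s 0 = result)"


section \<open>Encoding of inputs and outputs\<close>

text \<open>Positions are named by arbitrary bit strings.\<close>

type_synonym position = "bool list"

primrec enc_list :: "('a \<Rightarrow> tree) \<Rightarrow> 'a list \<Rightarrow> tree" where
  "enc_list e [] = Leaf"
| "enc_list e (x # xs) = Node (e x) (enc_list e xs)"

definition enc_bool :: "bool \<Rightarrow> tree" where
  "enc_bool b = (if b then Node Leaf Leaf else Leaf)"

text \<open>Unary numbers suffice, as \<open>m\<close> is the length of every listed evaluation.\<close>

definition enc_nat :: "nat \<Rightarrow> tree" where
  "enc_nat k = enc_list (\<lambda>_. Leaf) [0..<k]"

definition enc_position :: "position \<Rightarrow> tree" where
  "enc_position = enc_list enc_bool"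

definition enc_listing :: "position list list \<Rightarrow> tree" where
  "enc_listing = enc_list (enc_list enc_position)"

definition enc_input :: "position list \<Rightarrow> nat \<Rightarrow> position list list \<Rightarrow> tree" where
  "enc_input as m xs =
     Node (enc_listing xs) (Node (enc_nat m) (enc_list enc_position as))"

definition enc_tables :: "(position list \<times> position) list list \<Rightarrow> tree" where
  "enc_tables =
     enc_list (enc_list (\<lambda>(as, b). Node (enc_list enc_position as) (enc_position b)))"

text \<open>The output \<open>Leaf\<close> means that there is no binary non-dictatorial aggregator; an output with
  a root node means that there is one, and its right subtree holds the tables of one.\<close>

definition correct_output :: "nat \<Rightarrow> position list set \<Rightarrow> tree \<Rightarrow> bool" where
  "correct_output m X result \<longleftrightarrow>
     (if \<exists>F. non_dictatorial_aggregator 2 m X F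
      then \<exists>F Ts. non_dictatorial_aggregator 2 m X F \<and> tables 2 m X F Ts \<and>
             result = Node Leaf (enc_tables Ts)
      else result = Leaf)"

end

theory Submission
  imports Defs
begin

text \<open>
  Write a component function of a binary aggregator as a truth value for each triple \<open>(j, u, v)\<close> with
  \<open>u \<noteq> v\<close> in \<open>X\<^sub>j\<close>, namely whether \<open>f\<^sub>j(u, v) = u\<close>. Collective rationality then amounts to a set of
  implications between pairs of these truth values, so binary aggregators correspond to the closed
  vertex sets of a directed graph, and the non-dictatorial ones to the closed sets other than the
  empty set and the whole. Such a set exists iff some vertex does not reach all vertices, and the
  set of vertices reachable from it is a witness. The graph has polynomially many vertices, and its
  arcs can be tested by searching \<open>X\<close>.

  For the running time, a function on encoded data is called polynomial-time if a program of the
  WHILE language computes it and leaves all but finitely many variables untouched. This class is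
  closed under composition, pairing, case distinction and folds with polynomially bounded
  accumulators, hence under all list operations from which the algorithm is built. The input
  contains a listing of \<open>A\<close>, whose size is not bounded by that of \<open>X\<close>, so the program must drop it
  without ever copying it.
\<close>

section \<open>Polynomial bounds\<close>

lemma poly_nat_mono: "x \<le> y \<Longrightarrow> poly (p :: nat poly) x \<le> poly p y"
  by (induction p) (auto intro: add_mono mult_mono)

text \<open>Natural coefficients make every bounding polynomial monotone, so a bound on an
  intermediate size can be substituted into a later bound.\<close>

definition poly_bounded :: "('a \<Rightarrow> tree) \<Rightarrow> ('a \<Rightarrow> nat) \<Rightarrow> bool" where
  "poly_bounded e g \<longleftrightarrow> (\<exists>p. \<forall>x. g x \<le> poly p (cells (e x)))"

lemma poly_bounded_const: "poly_bounded e (\<lambda>x. k)"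
  unfolding poly_bounded_def by (rule exI[of _ "[:k:]"]) simp

lemma poly_bounded_cells: "poly_bounded e (\<lambda>x. cells (e x))"
  unfolding poly_bounded_def by (rule exI[of _ "[:0, 1:]"]) simp

lemma poly_bounded_add:
  "poly_bounded e f \<Longrightarrow> poly_bounded e g \<Longrightarrow> poly_bounded e (\<lambda>x. f x + g x)"
  unfolding poly_bounded_def by (metis add_mono poly_add)

lemma poly_bounded_Suc: "poly_bounded e f \<Longrightarrow> poly_bounded e (\<lambda>x. Suc (f x))"
  using poly_bounded_add[OF poly_bounded_const[of e 1]] by simp

lemma poly_bounded_mult:
  "poly_bounded e f \<Longrightarrow> poly_bounded e g \<Longrightarrow> poly_bounded e (\<lambda>x. f x * g x)"
  unfolding poly_bounded_def by (metis mult_le_mono poly_mult)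

lemma poly_bounded_mono:
  "poly_bounded e g \<Longrightarrow> (\<And>x. f x \<le> g x) \<Longrightarrow> poly_bounded e f"
  unfolding poly_bounded_def by (meson le_trans)

lemma poly_bounded_poly: "poly_bounded e f \<Longrightarrow> poly_bounded e (\<lambda>x. poly p (f x))"
  unfolding poly_bounded_def by (metis poly_nat_mono poly_pcompose)

lemma poly_bounded_comp:
  assumes "poly_bounded e' g" and "poly_bounded e (\<lambda>x. cells (e' (f x)))"
  shows "poly_bounded e (\<lambda>x. g (f x))"
proof -
  obtain p where p: "\<And>y. g y \<le> poly p (cells (e' y))"
    using assms(1) unfolding poly_bounded_def by blast
  show ?thesis
    by (rule poly_bounded_mono[OF poly_bounded_poly[OF assms(2), of p]]) (rule p)
qed

lemmas poly_bounded_intros =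
  poly_bounded_const poly_bounded_cells poly_bounded_add poly_bounded_Suc poly_bounded_mult
  poly_bounded_poly


section \<open>Functions computable in polynomial time\<close>

text \<open>Upper bounds on the time add up along a program, which spares the exact step
  counts.\<close>

definition runs :: "com \<Rightarrow> state \<Rightarrow> nat \<Rightarrow> state \<Rightarrow> bool" where
  "runs c s b s' \<longleftrightarrow> (\<exists>t\<le>b. exec c s t s')"

lemma runs_mono: "runs c s b s' \<Longrightarrow> b \<le> b' \<Longrightarrow> runs c s b' s'"
  unfolding runs_def by (meson le_trans)

lemma runs_Assign: "runs (Assign v e) s (cost_exp e s) (s(v := eval_exp e s))"
  unfolding runs_def using exec.Assign by blast

lemma runs_Assign_le:
  "eval_exp e s = v \<Longrightarrow> Suc (cells v) \<le> b \<Longrightarrow> runs (Assign x e) s b (s(x := v))"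
  using runs_mono[OF runs_Assign] by (auto simp: cost_exp_def)

lemma runs_Seq: "runs c1 s b1 s' \<Longrightarrow> runs c2 s' b2 s'' \<Longrightarrow> runs (Seq c1 c2) s (b1 + b2) s''"
  unfolding runs_def by (meson exec.Seq add_mono)

lemma runs_CondTrue:
  "eval_exp e s \<noteq> Leaf \<Longrightarrow> runs c1 s b s' \<Longrightarrow> runs (Cond e c1 c2) s (cost_exp e s + b) s'"
  unfolding runs_def by (meson exec.CondTrue add_left_mono)

lemma runs_CondFalse:
  "eval_exp e s = Leaf \<Longrightarrow> runs c2 s b s' \<Longrightarrow> runs (Cond e c1 c2) s (cost_exp e s + b) s'"
  unfolding runs_def by (meson exec.CondFalse add_left_mono)

lemma runs_WhileFalse: "eval_exp e s = Leaf \<Longrightarrow> runs (While e c) s (cost_exp e s) s"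
  unfolding runs_def by (meson exec.WhileFalse order_refl)

lemma runs_WhileTrue:
  "eval_exp e s \<noteq> Leaf \<Longrightarrow> runs c s b1 s' \<Longrightarrow> runs (While e c) s' b2 s'' \<Longrightarrow>
    runs (While e c) s (cost_exp e s + b1 + b2) s''"
  unfolding runs_def by (meson exec.WhileTrue add_mono order_refl)

text \<open>The frame condition is what allows programs to be composed without renaming variables:
  a caller keeps its own data in variables above \<open>N\<close>. Nothing is assumed about the initial values
  of the variables other than \<open>0\<close>.\<close>

definition ptime :: "('a \<Rightarrow> tree) \<Rightarrow> ('b \<Rightarrow> tree) \<Rightarrow> ('a \<Rightarrow> 'b) \<Rightarrow> bool" where
  "ptime e e' f \<longleftrightarrow> poly_bounded e (\<lambda>x. cells (e' (f x))) \<and>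
     (\<exists>c N T. poly_bounded e T \<and>
       (\<forall>x s. s 0 = e x \<longrightarrow>
          (\<exists>s'. runs c s (T x) s' \<and> s' 0 = e' (f x) \<and> (\<forall>i>N. s' i = s i))))"

lemma ptimeE:
  assumes "ptime e e' f"
  obtains c N T where "poly_bounded e T"
    and "\<And>x s. s 0 = e x \<Longrightarrow>
          \<exists>s'. runs c s (T x) s' \<and> s' 0 = e' (f x) \<and> (\<forall>i>N. s' i = s i)"
  using assms unfolding ptime_def by blast

text \<open>The size of the output controls the running time of whatever is computed from it
  next.\<close>

lemma ptime_size: "ptime e e' f \<Longrightarrow> poly_bounded e (\<lambda>x. cells (e' (f x)))"
  unfolding ptime_def by blast

lemma ptimeI:
  assumes "poly_bounded e (\<lambda>x. cells (e' (f x)))" and "poly_bounded e T"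
    and "\<And>x s. s 0 = e x \<Longrightarrow>
          \<exists>s'. runs c s (T x) s' \<and> s' 0 = e' (f x) \<and> (\<forall>i>N. s' i = s i)"
  shows "ptime e e' f"
  unfolding ptime_def using assms by blast

text \<open>An assignment costs one more than the size of its value, so the bound on the output size
  already bounds the time.\<close>

lemma ptime_exp:
  assumes "poly_bounded e (\<lambda>x. cells (e' (f x)))"
    and "\<And>x s. s 0 = e x \<Longrightarrow> eval_exp a s = e' (f x)"
  shows "ptime e e' f"
proof (rule ptimeI[where c = "Assign 0 a" and T = "\<lambda>x. Suc (cells (e' (f x)))" and N = 0])
  fix x and s :: state assume "s 0 = e x"
  then show "\<exists>s'. runs (Assign 0 a) s (Suc (cells (e' (f x)))) s' \<and> s' 0 = e' (f x) \<and>
      (\<forall>i>0. s' i = s i)"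
    using runs_Assign[of 0 a s] assms(2)[of s x] by (auto simp: cost_exp_def)
qed (use assms(1) in \<open>auto intro: poly_bounded_Suc\<close>)

lemma ptime_id: "ptime e e (\<lambda>x. x)"
  by (rule ptime_exp[where a = "Var 0"]) (auto intro: poly_bounded_intros)

text \<open>The second program takes time polynomial in the size of \<open>f x\<close>, which is
  polynomial in the size of \<open>x\<close>. It may start in whatever variables the first one
  leaves behind, because only variable \<open>0\<close> is prescribed.\<close>

lemma ptime_comp:
  assumes "ptime e2 e3 g" and "ptime e1 e2 f"
  shows "ptime e1 e3 (\<lambda>x. g (f x))"
proof -
  obtain c1 N1 T1 where T1: "poly_bounded e1 T1"
    and c1: "\<And>x s. s 0 = e1 x \<Longrightarrow>
          \<exists>s'. runs c1 s (T1 x) s' \<and> s' 0 = e2 (f x) \<and> (\<forall>i>N1. s' i = s i)"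
    by (rule ptimeE[OF assms(2)]) (rule that)
  obtain c2 N2 T2 where T2: "poly_bounded e2 T2"
    and c2: "\<And>x s. s 0 = e2 x \<Longrightarrow>
          \<exists>s'. runs c2 s (T2 x) s' \<and> s' 0 = e3 (g x) \<and> (\<forall>i>N2. s' i = s i)"
    by (rule ptimeE[OF assms(1)]) (rule that)
  show ?thesis
  proof (rule ptimeI[where c = "Seq c1 c2" and T = "\<lambda>x. T1 x + T2 (f x)" and N = "max N1 N2"])
    show "poly_bounded e1 (\<lambda>x. cells (e3 (g (f x))))"
      using ptime_size[OF assms(1)] ptime_size[OF assms(2)] by (rule poly_bounded_comp)
    show "poly_bounded e1 (\<lambda>x. T1 x + T2 (f x))"
      by (intro poly_bounded_add T1 poly_bounded_comp[OF T2] ptime_size[OF assms(2)])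
    fix x and s :: state assume "s 0 = e1 x"
    then obtain s' where s': "runs c1 s (T1 x) s'" "s' 0 = e2 (f x)" "\<forall>i>N1. s' i = s i"
      using c1 by blast
    then obtain s'' where "runs c2 s' (T2 (f x)) s''" "s'' 0 = e3 (g (f x))" "\<forall>i>N2. s'' i = s' i"
      using c2 by blast
    with s' show "\<exists>s'. runs (Seq c1 c2) s (T1 x + T2 (f x)) s' \<and> s' 0 = e3 (g (f x)) \<and>
        (\<forall>i>max N1 N2. s' i = s i)"
      using runs_Seq by (intro exI[of _ s'']) auto
  qed
qed

section \<open>Pairs, constants and case distinction\<close>

definition enc_pair :: "('a \<Rightarrow> tree) \<Rightarrow> ('b \<Rightarrow> tree) \<Rightarrow> 'a \<times> 'b \<Rightarrow> tree" where
  "enc_pair e1 e2 p = Node (e1 (fst p)) (e2 (snd p))"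

lemma cells_enc_pair [simp]: "cells (enc_pair e1 e2 p) = Suc (cells (e1 (fst p)) + cells (e2 (snd p)))"
  by (simp add: enc_pair_def)

lemma ptime_fst: "ptime e (enc_pair e1 e2) f \<Longrightarrow> ptime e e1 (\<lambda>x. fst (f x))"
proof (erule ptime_comp[rotated])
  show "ptime (enc_pair e1 e2) e1 fst"
    by (rule ptime_exp[where a = "Hd_exp (Var 0)"])
      (auto simp: enc_pair_def intro: poly_bounded_mono[OF poly_bounded_cells])
qed

lemma ptime_snd: "ptime e (enc_pair e1 e2) f \<Longrightarrow> ptime e e2 (\<lambda>x. snd (f x))"
proof (erule ptime_comp[rotated])
  show "ptime (enc_pair e1 e2) e2 snd"
    by (rule ptime_exp[where a = "Tl_exp (Var 0)"])
      (auto simp: enc_pair_def intro: poly_bounded_mono[OF poly_bounded_cells])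
qed

lemmas ptime_var = ptime_fst ptime_snd ptime_id

lemma ptime_const: "ptime e e' (\<lambda>x. k)"
proof -
  \<comment> \<open>Every fixed tree is the value of a closed expression.\<close>
  have "\<exists>a. \<forall>s. eval_exp a s = t" for t
  proof (induction t)
    case Leaf
    show ?case by (rule exI[of _ Nil_exp]) simp
  next
    case (Node l r)
    then obtain a b where "\<forall>s. eval_exp a s = l" "\<forall>s. eval_exp b s = r" by blast
    then show ?case by (intro exI[of _ "Cons_exp a b"]) simp
  qed
  then obtain a where "\<And>s. eval_exp a s = e' k" by blast
  then show ?thesis by (intro ptime_exp[where a = a] poly_bounded_const)
qed

text \<open>Both programs need the same input, so a copy of it is kept in variable \<open>M\<close>
  while the first one runs; the first result then waits in \<open>Suc M\<close> while the second one
  runs. Nested pairs also carry the surrounding variables into the bodies of case distinctions, maps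
  and folds.\<close>

lemma ptime_Pair:
  assumes "ptime e e1 f" and "ptime e e2 g"
  shows "ptime e (enc_pair e1 e2) (\<lambda>x. (f x, g x))"
proof -
  obtain c1 N1 T1 where T1: "poly_bounded e T1"
    and c1: "\<And>x s. s 0 = e x \<Longrightarrow>
          \<exists>s'. runs c1 s (T1 x) s' \<and> s' 0 = e1 (f x) \<and> (\<forall>i>N1. s' i = s i)"
    by (rule ptimeE[OF assms(1)]) (rule that)
  obtain c2 N2 T2 where T2: "poly_bounded e T2"
    and c2: "\<And>x s. s 0 = e x \<Longrightarrow>
          \<exists>s'. runs c2 s (T2 x) s' \<and> s' 0 = e2 (g x) \<and> (\<forall>i>N2. s' i = s i)"
    by (rule ptimeE[OF assms(2)]) (rule that)
  \<comment> \<open>By the frame conditions, neither program changes a variable from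
    \<open>M\<close> on.\<close>
  define M where "M = Suc (max N1 N2)"
  have M: "M > N1" "M > N2" "M > 0" by (auto simp: M_def)
  define c where "c = Seq (Assign M (Var 0)) (Seq c1 (Seq (Assign (Suc M) (Var 0))
    (Seq (Assign 0 (Var M)) (Seq c2 (Assign 0 (Cons_exp (Var (Suc M)) (Var 0)))))))"
  define T where "T = (\<lambda>x. Suc (cells (e x)) + (T1 x + (Suc (cells (e1 (f x))) +
     (Suc (cells (e x)) + (T2 x + Suc (Suc (cells (e1 (f x)) + cells (e2 (g x)))))))))"
  note size = ptime_size[OF assms(1)] ptime_size[OF assms(2)]
  show ?thesis
  proof (rule ptimeI[where c = c and T = T and N = "Suc M"])
    show "poly_bounded e (\<lambda>x. cells (enc_pair e1 e2 (f x, g x)))"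
      by (simp, intro poly_bounded_intros size)
    show "poly_bounded e T"
      unfolding T_def by (intro poly_bounded_intros size T1 T2)
    fix x and s :: state assume s: "s 0 = e x"
    define s1 where "s1 = s(M := e x)"
    have r1: "runs (Assign M (Var 0)) s (Suc (cells (e x))) s1"
      using runs_Assign[of M "Var 0" s] s by (simp add: s1_def cost_exp_def)
    obtain s2 where s2: "runs c1 s1 (T1 x) s2" "s2 0 = e1 (f x)" "\<forall>i>N1. s2 i = s1 i"
      using c1[of s1 x] s M by (auto simp: s1_def)
    define s3 where "s3 = s2(Suc M := e1 (f x))"
    have r3: "runs (Assign (Suc M) (Var 0)) s2 (Suc (cells (e1 (f x)))) s3"
      using runs_Assign[of "Suc M" "Var 0" s2] s2 by (simp add: s3_def cost_exp_def)
    have "s3 M = e x" using s2(3) M by (simp add: s3_def s1_def)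
    define s4 where "s4 = s3(0 := e x)"
    have r4: "runs (Assign 0 (Var M)) s3 (Suc (cells (e x))) s4"
      using runs_Assign[of 0 "Var M" s3] \<open>s3 M = e x\<close> by (simp add: s4_def cost_exp_def)
    obtain s5 where s5: "runs c2 s4 (T2 x) s5" "s5 0 = e2 (g x)" "\<forall>i>N2. s5 i = s4 i"
      using c2[of s4 x] by (auto simp: s4_def)
    have "s5 (Suc M) = e1 (f x)" using s5(3) M by (simp add: s4_def s3_def)
    define s6 where "s6 = s5(0 := Node (e1 (f x)) (e2 (g x)))"
    have r6: "runs (Assign 0 (Cons_exp (Var (Suc M)) (Var 0))) s5
        (Suc (Suc (cells (e1 (f x)) + cells (e2 (g x))))) s6"
      using runs_Assign[of 0 "Cons_exp (Var (Suc M)) (Var 0)" s5] \<open>s5 (Suc M) = _\<close> s5(2)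
      by (simp add: s6_def cost_exp_def)
    have "runs c s (T x) s6"
      unfolding c_def T_def
      by (rule runs_Seq[OF r1 runs_Seq[OF s2(1) runs_Seq[OF r3 runs_Seq[OF r4 runs_Seq[OF s5(1) r6]]]]])
    moreover have "\<forall>i>Suc M. s6 i = s i"
      using s5(3) s2(3) M by (auto simp: s6_def s4_def s3_def s1_def)
    ultimately show "\<exists>s'. runs c s (T x) s' \<and> s' 0 = enc_pair e1 e2 (f x, g x) \<and>
        (\<forall>i>Suc M. s' i = s i)"
      by (intro exI[of _ s6]) (simp add: s6_def enc_pair_def)
  qed
qed

lemma ptime_comp2:
  assumes "ptime (enc_pair e1 e2) e3 (\<lambda>p. h (fst p) (snd p))"
    and "ptime e e1 f" and "ptime e e2 g"
  shows "ptime e e3 (\<lambda>x. h (f x) (g x))"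
  using ptime_comp[OF assms(1) ptime_Pair[OF assms(2,3)]] by simp

lemma ptime_comp3:
  assumes "ptime (enc_pair e1 (enc_pair e2 e3)) e4 (\<lambda>p. h (fst p) (fst (snd p)) (snd (snd p)))"
    and "ptime e e1 f" and "ptime e e2 g" and "ptime e e3 k"
  shows "ptime e e4 (\<lambda>x. h (f x) (g x) (k x))"
  using ptime_comp[OF assms(1) ptime_Pair[OF assms(2) ptime_Pair[OF assms(3,4)]]] by simp

lemma ptime_case_list:
  assumes "ptime e (enc_list ea) l" and "ptime e e' f"
    and "ptime (enc_pair e (enc_pair ea (enc_list ea))) e' (\<lambda>p. g (fst p) (fst (snd p)) (snd (snd p)))"
  shows "ptime e e' (\<lambda>x. case l x of [] \<Rightarrow> f x | a # as \<Rightarrow> g x a as)"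
proof -
  obtain c1 N1 T1 where T1: "poly_bounded e T1"
    and c1: "\<And>x s. s 0 = e x \<Longrightarrow>
          \<exists>s'. runs c1 s (T1 x) s' \<and> s' 0 = e' (f x) \<and> (\<forall>i>N1. s' i = s i)"
    by (rule ptimeE[OF assms(2)]) (rule that)
  define e2 where "e2 = enc_pair e (enc_pair ea (enc_list ea))"
  obtain c2 N2 T2 where T2: "poly_bounded e2 T2"
    and c2: "\<And>p s. s 0 = e2 p \<Longrightarrow> \<exists>s'. runs c2 s (T2 p) s' \<and>
          s' 0 = e' (g (fst p) (fst (snd p)) (snd (snd p))) \<and> (\<forall>i>N2. s' i = s i)"
    by (rule ptimeE[OF assms(3), folded e2_def]) (rule that)
  \<comment> \<open>The program works on the pair of the list and \<open>x\<close>: the head of this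
    pair is \<open>Leaf\<close> iff the list is empty, so it can serve as the condition.\<close>
  define e1 where "e1 = enc_pair (enc_list ea) e"
  define h where "h = (\<lambda>q. case fst q of [] \<Rightarrow> f (snd q) | a # as \<Rightarrow> g (snd q) a as)"
  define c where "c = Cond (Hd_exp (Var 0))
    (Seq (Assign 0 (Cons_exp (Tl_exp (Var 0)) (Hd_exp (Var 0)))) c2)
    (Seq (Assign 0 (Tl_exp (Var 0))) c1)"
  \<comment> \<open>For an empty list there is no argument at which to evaluate \<open>T2\<close>.
    Its bounding polynomial, applied to the size of the whole pair, makes sense in both
    cases.\<close>
  obtain p2 where p2: "\<And>y. T2 y \<le> poly p2 (cells (e2 y))"
    using T2 unfolding poly_bounded_def by blast
  obtain q2 where q2: "\<And>y. cells (e' (g (fst y) (fst (snd y)) (snd (snd y)))) \<le> poly q2 (cells (e2 y))"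
    using ptime_size[OF assms(3)] unfolding poly_bounded_def e2_def by blast
  define T where "T = (\<lambda>q. Suc (cells (enc_list ea (fst q))) +
    (Suc (cells (e1 q)) + (T1 (snd q) + poly p2 (cells (e1 q)))))"
  have snd: "poly_bounded e1 (\<lambda>q. cells (e (snd q)))"
    unfolding e1_def by (rule ptime_size[OF ptime_snd[OF ptime_id]])
  have fst: "poly_bounded e1 (\<lambda>q. cells (enc_list ea (fst q)))"
    unfolding e1_def by (rule ptime_size[OF ptime_fst[OF ptime_id]])
  \<comment> \<open>Regrouping the three components leaves the number of cells unchanged.\<close>
  have size_eq: "cells (e2 (x, a, as)) = cells (e1 (a # as, x))" for x a as
    by (simp add: e1_def e2_def)
  have "ptime e1 e' h"
  proof (rule ptimeI[where c = c and T = T and N = "max N1 N2"])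
    have "cells (e' (h q)) \<le> cells (e' (f (snd q))) + poly q2 (cells (e1 q))" for q
    proof (cases "fst q")
      case (Cons a as)
      then have "e1 q = e1 (a # as, snd q)" by (simp add: e1_def enc_pair_def)
      then show ?thesis using q2[of "(snd q, a, as)"] Cons by (simp add: h_def size_eq)
    qed (simp add: h_def)
    then show "poly_bounded e1 (\<lambda>q. cells (e' (h q)))"
      by (rule poly_bounded_mono[rotated])
        (intro poly_bounded_intros poly_bounded_comp[OF ptime_size[OF assms(2)] snd])
    show "poly_bounded e1 T"
      unfolding T_def
      by (intro poly_bounded_intros snd fst poly_bounded_comp[OF T1 snd])
    fix q and s :: state assume s: "s 0 = e1 q"
    show "\<exists>s'. runs c s (T q) s' \<and> s' 0 = e' (h q) \<and> (\<forall>i>max N1 N2. s' i = s i)"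
    proof (cases "fst q")
      case Nil
      define s1 where "s1 = s(0 := e (snd q))"
      have r1: "runs (Assign 0 (Tl_exp (Var 0))) s (Suc (cells (e (snd q)))) s1"
        using runs_Assign[of 0 "Tl_exp (Var 0)" s] s
        by (simp add: s1_def cost_exp_def enc_pair_def e1_def)
      obtain s2 where s2: "runs c1 s1 (T1 (snd q)) s2" "s2 0 = e' (f (snd q))" "\<forall>i>N1. s2 i = s1 i"
        using c1[of s1 "snd q"] by (auto simp: s1_def)
      have "runs c s (cost_exp (Hd_exp (Var 0)) s + (Suc (cells (e (snd q))) + T1 (snd q))) s2"
        unfolding c_def using s Nil
        by (intro runs_CondFalse runs_Seq[OF r1 s2(1)]) (simp add: e1_def enc_pair_def)
      then have "runs c s (T q) s2"
        by (rule runs_mono) (use s in \<open>simp add: T_def cost_exp_def e1_def enc_pair_def\<close>)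
      with s2 Nil show ?thesis by (intro exI[of _ s2]) (auto simp: h_def s1_def)
    next
      case (Cons a as)
      define y where "y = (snd q, a, as)"
      have q: "q = (a # as, snd q)" using Cons by (simp add: prod_eq_iff)
      define s1 where "s1 = s(0 := e2 y)"
      have r1: "runs (Assign 0 (Cons_exp (Tl_exp (Var 0)) (Hd_exp (Var 0)))) s (Suc (cells (e2 y))) s1"
        using runs_Assign[of 0 "Cons_exp (Tl_exp (Var 0)) (Hd_exp (Var 0))" s] s Cons
        by (simp add: s1_def cost_exp_def enc_pair_def e1_def e2_def y_def)
      obtain s2 where s2: "runs c2 s1 (T2 y) s2" "s2 0 = e' (h q)" "\<forall>i>N2. s2 i = s1 i"
        using c2[of s1 y] Cons by (auto simp: s1_def h_def y_def)
      have "runs c s (cost_exp (Hd_exp (Var 0)) s + (Suc (cells (e2 y)) + T2 y)) s2"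
        unfolding c_def using s Cons
        by (intro runs_CondTrue runs_Seq[OF r1 s2(1)]) (simp add: e1_def enc_pair_def)
      then have "runs c s (T q) s2"
      proof (rule runs_mono)
        have "cells (e2 y) = cells (e1 q)" using size_eq q by (metis y_def)
        then show "cost_exp (Hd_exp (Var 0)) s + (Suc (cells (e2 y)) + T2 y) \<le> T q"
          using p2[of y] s by (simp add: T_def cost_exp_def e1_def enc_pair_def)
      qed
      with s2 show ?thesis by (intro exI[of _ s2]) (auto simp: s1_def)
    qed
  qed
  from ptime_comp[OF this, unfolded e1_def, OF ptime_Pair[OF assms(1) ptime_id]] show ?thesis
    by (simp add: h_def cong: list.case_cong)
qed

text \<open>A truth value has the code of a list with at most one entry, which reduces conditionals
  to case distinction on lists.\<close>

lemma enc_bool_eq: "enc_bool b = enc_list (\<lambda>_. Leaf) (if b then [()] else [])"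
  by (simp add: enc_bool_def)

lemma ptime_if:
  assumes "ptime e enc_bool b" and "ptime e e' f" and "ptime e e' g"
  shows "ptime e e' (\<lambda>x. if b x then f x else g x)"
proof -
  have "ptime e (enc_list (\<lambda>_. Leaf)) (\<lambda>x. if b x then [()] else [])"
    using assms(1) unfolding ptime_def enc_bool_eq .
  from ptime_case_list[OF this assms(3) ptime_comp[OF assms(2) ptime_fst[OF ptime_id]]]
  have "ptime e e' (\<lambda>x. case if b x then [()] else [] of [] \<Rightarrow> g x | _ \<Rightarrow> f x)" .
  also have "(\<lambda>x. case if b x then [()] else [] of [] \<Rightarrow> g x | _ \<Rightarrow> f x) =
      (\<lambda>x. if b x then f x else g x)" by auto
  finally show ?thesis .
qed

section \<open>Sizes of encoded lists, and folds with bounded accumulators\<close>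

lemma cells_enc_list: "cells (enc_list e l) = (\<Sum>a\<leftarrow>l. Suc (cells (e a)))"
  by (induction l) auto

lemma length_le_cells: "length l \<le> cells (enc_list e l)"
  by (induction l) auto

lemma cells_le_cells_enc_list: "a \<in> set l \<Longrightarrow> cells (e a) \<le> cells (enc_list e l)"
  by (induction l) auto

lemma cells_enc_list_append [simp]:
  "cells (enc_list e (l @ l')) = cells (enc_list e l) + cells (enc_list e l')"
  by (simp add: cells_enc_list)

lemma cells_enc_list_rev [simp]: "cells (enc_list e (rev l)) = cells (enc_list e l)"
  by (simp add: cells_enc_list rev_map[symmetric] sum_list_rev)

lemma cells_enc_list_take: "cells (enc_list e (take k l)) \<le> cells (enc_list e l)"
  by (metis append_take_drop_id cells_enc_list_append le_add1)

lemma cells_enc_list_drop: "cells (enc_list e (drop k l)) \<le> cells (enc_list e l)"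
  by (metis append_take_drop_id cells_enc_list_append le_add2)

text \<open>Variable \<open>M\<close> holds the rest of the list, \<open>Suc M\<close> the fixed
  parameter and \<open>Suc (Suc M)\<close> the accumulator; variable \<open>0\<close> passes data to
  and from the body. \<open>D\<close> bounds the cost of each test and assignment, the summand
  \<open>3\<close> paying for two pairing nodes and the unit charge. The term \<open>5 * D\<close>
  covers one test and three assignments per round, and the final \<open>1\<close> the failing
  test.\<close>

lemma runs_fold:
  fixes h :: "'a \<Rightarrow> 'b \<Rightarrow> 'b" and M :: nat
  defines "loop \<equiv> (\<lambda>c. While (Var M)
    (Seq (Assign 0 (Cons_exp (Var (Suc M)) (Cons_exp (Hd_exp (Var M)) (Var (Suc (Suc M))))))
    (Seq c (Seq (Assign (Suc (Suc M)) (Var 0)) (Assign M (Tl_exp (Var M)))))))"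
  assumes c: "\<And>a acc s. s 0 = Node t (Node (ea a) (eb acc)) \<Longrightarrow>
        \<exists>s'. runs c s (T (cells (s 0))) s' \<and> s' 0 = eb (h a acc) \<and> (\<forall>i\<ge>M. s' i = s i)"
    and T: "mono T" and M: "M > 0"
    and "s M = enc_list ea l" and "s (Suc M) = t" and "s (Suc (Suc M)) = eb acc"
    and "cells (enc_list ea l) \<le> L" and "\<And>k. cells (eb (fold h (take k l) acc)) \<le> K"
  defines "D \<equiv> cells t + L + K + 3"
  shows "\<exists>s'. runs (loop c) s (length l * (T D + 5 * D) + 1) s' \<and>
    s' (Suc (Suc M)) = eb (fold h l acc) \<and> (\<forall>i>Suc (Suc M). s' i = s i)"
  using assms(5-9)
\<comment> \<open>\<open>L\<close> and \<open>K\<close> stay fixed, so that every round is charged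
  with the same \<open>D\<close>.\<close>
proof (induction l arbitrary: s acc)
  case Nil
  have "runs (loop c) s (cost_exp (Var M) s) s"
    unfolding loop_def by (rule runs_WhileFalse) (use Nil in simp)
  then show ?case using Nil by (intro exI[of _ s]) (simp add: cost_exp_def)
next
  case (Cons a l)
  have K0: "cells (eb acc) \<le> K" using Cons.prems(5)[of 0] by simp
  have K1: "cells (eb (h a acc)) \<le> K" using Cons.prems(5)[of 1] by simp
  have L: "cells (ea a) + cells (enc_list ea l) < L" using Cons.prems(4) by simp
  define u where "u = Node t (Node (ea a) (eb acc))"
  have u: "Suc (cells u) \<le> D" using K0 L by (simp add: u_def D_def)
  define s1 where "s1 = s(0 := u)"
  have r1: "runs (Assign 0 (Cons_exp (Var (Suc M)) (Cons_exp (Hd_exp (Var M)) (Var (Suc (Suc M)))))) s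
      D s1"
    unfolding s1_def by (rule runs_Assign_le) (use Cons.prems u in \<open>auto simp: u_def\<close>)
  obtain s2 where s2: "runs c s1 (T (cells u)) s2" "s2 0 = eb (h a acc)" "\<forall>i\<ge>M. s2 i = s1 i"
    using c[of s1 a acc] by (auto simp: s1_def u_def)
  have r2: "runs c s1 (T D) s2"
    using s2(1) by (rule runs_mono) (use u in \<open>auto intro: monoD[OF T]\<close>)
  define s3 where "s3 = s2(Suc (Suc M) := eb (h a acc))"
  have r3: "runs (Assign (Suc (Suc M)) (Var 0)) s2 D s3"
    unfolding s3_def by (rule runs_Assign_le) (use s2(2) K1 in \<open>auto simp: D_def\<close>)
  define s4 where "s4 = s3(M := enc_list ea l)"
  have "s3 M = enc_list ea (a # l)"
    using s2(3) M Cons.prems(1) by (simp add: s3_def s1_def)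
  then have r4: "runs (Assign M (Tl_exp (Var M))) s3 D s4"
    unfolding s4_def by (intro runs_Assign_le) (use L in \<open>auto simp: D_def\<close>)
  have "\<exists>s'. runs (loop c) s4 (length l * (T D + 5 * D) + 1) s' \<and>
    s' (Suc (Suc M)) = eb (fold h l (h a acc)) \<and> (\<forall>i>Suc (Suc M). s' i = s4 i)"
  proof (rule Cons.IH)
    show "s4 M = enc_list ea l" "s4 (Suc (Suc M)) = eb (h a acc)" by (auto simp: s4_def s3_def)
    show "s4 (Suc M) = t"
      using s2(3) M Cons.prems(2) by (simp add: s4_def s3_def s1_def)
    show "cells (enc_list ea l) \<le> L" using L by simp
    show "cells (eb (fold h (take k l) (h a acc))) \<le> K" for k
      using Cons.prems(5)[of "Suc k"] by simp
  qed
  then obtain s5 where s5: "runs (loop c) s4 (length l * (T D + 5 * D) + 1) s5"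
    "s5 (Suc (Suc M)) = eb (fold h l (h a acc))" "\<forall>i>Suc (Suc M). s5 i = s4 i" by blast
  have "runs (loop c) s (cost_exp (Var M) s + (D + (T D + (D + D))) + (length l * (T D + 5 * D) + 1)) s5"
    unfolding loop_def
    by (rule runs_WhileTrue[OF _ _ s5(1)[unfolded loop_def]], use Cons.prems(1) in simp)
      (rule runs_Seq[OF r1 runs_Seq[OF r2 runs_Seq[OF r3 r4]]])
  moreover have "cost_exp (Var M) s \<le> D"
    using Cons.prems(1) L by (simp add: cost_exp_def D_def)
  ultimately have "runs (loop c) s (length (a # l) * (T D + 5 * D) + 1) s5"
    by (elim runs_mono) simp
  moreover have "\<forall>i>Suc (Suc M). s5 i = s i"
    using s5(3) s2(3) M by (auto simp: s4_def s3_def s1_def)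
  ultimately show ?case using s5(2) by (intro exI[of _ s5]) simp
qed

text \<open>A polynomial-time body is not enough, since an accumulator that doubles in each round
  grows exponentially. Hence the bound \<open>K\<close> is required after every prefix of the
  list.\<close>

lemma ptime_fold:
  assumes l: "ptime e (enc_list ea) l" and a0: "ptime e eb a0"
    and h: "ptime (enc_pair e (enc_pair ea eb)) eb (\<lambda>p. h (fst p) (fst (snd p)) (snd (snd p)))"
    and K: "poly_bounded e K" and le: "\<And>x k. cells (eb (fold (h x) (take k (l x)) (a0 x))) \<le> K x"
  shows "ptime e eb (\<lambda>x. fold (h x) (l x) (a0 x))"
proof -
  define e3 where "e3 = enc_pair e (enc_pair ea eb)"
  obtain c N T3 where T3: "poly_bounded e3 T3"
    and c: "\<And>p s. s 0 = e3 p \<Longrightarrow> \<exists>s'. runs c s (T3 p) s' \<and>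
          s' 0 = eb (h (fst p) (fst (snd p)) (snd (snd p))) \<and> (\<forall>i>N. s' i = s i)"
    by (rule ptimeE[OF h, folded e3_def]) (rule that)
  obtain P where P: "\<And>y. T3 y \<le> poly P (cells (e3 y))"
    using T3 unfolding poly_bounded_def by blast
  define M where "M = Suc N"
  define E where "E = enc_pair e (enc_pair (enc_list ea) eb)"
  define loop where "loop = While (Var M)
    (Seq (Assign 0 (Cons_exp (Var (Suc M)) (Cons_exp (Hd_exp (Var M)) (Var (Suc (Suc M))))))
    (Seq c (Seq (Assign (Suc (Suc M)) (Var 0)) (Assign M (Tl_exp (Var M))))))"
  define prog where "prog = Seq (Assign (Suc M) (Hd_exp (Var 0)))
    (Seq (Assign M (Hd_exp (Tl_exp (Var 0)))) (Seq (Assign (Suc (Suc M)) (Tl_exp (Tl_exp (Var 0))))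
    (Seq loop (Assign 0 (Var (Suc (Suc M)))))))"
  obtain c1 N1 T1 where T1: "poly_bounded e T1"
    and c1: "\<And>x s. s 0 = e x \<Longrightarrow> \<exists>s'. runs c1 s (T1 x) s' \<and>
          s' 0 = E (x, l x, a0 x) \<and> (\<forall>i>N1. s' i = s i)"
    by (rule ptimeE[OF ptime_Pair[OF ptime_id ptime_Pair[OF l a0]], folded E_def]) (rule that)
  define D where "D = (\<lambda>x. cells (e x) + cells (enc_list ea (l x)) + K x + 3)"
  \<comment> \<open>The number of rounds is the length of the list, which is at most the size of its
    code.\<close>
  define B where "B = (\<lambda>x. cells (enc_list ea (l x)) * (poly P (D x) + 5 * D x) + 1)"
  define T where "T = (\<lambda>x. T1 x + (D x + (D x + (D x + (B x + D x)))))"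
  have D: "poly_bounded e D"
    unfolding D_def by (intro poly_bounded_intros K ptime_size[OF l])
  show ?thesis
  proof (rule ptimeI[where c = "Seq c1 prog" and T = T and N = "max N1 (Suc (Suc M))"])
    show "poly_bounded e (\<lambda>x. cells (eb (fold (h x) (l x) (a0 x))))"
      using K by (rule poly_bounded_mono) (metis le order_refl take_all)
    show "poly_bounded e T"
      unfolding T_def B_def by (intro poly_bounded_intros D T1 ptime_size[OF l])
    fix x and s :: state assume "s 0 = e x"
    then obtain s1 where s1: "runs c1 s (T1 x) s1" "s1 0 = E (x, l x, a0 x)" "\<forall>i>N1. s1 i = s i"
      using c1 by blast
    \<comment> \<open>The triple of parameter, list and initial accumulator stays in variable
      \<open>0\<close> while its components are moved to the variables of the loop.\<close>
    define s2 where "s2 = s1(Suc M := e x)"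
    have r2: "runs (Assign (Suc M) (Hd_exp (Var 0))) s1 (D x) s2"
      unfolding s2_def by (rule runs_Assign_le) (auto simp: s1(2) E_def enc_pair_def D_def)
    define s3 where "s3 = s2(M := enc_list ea (l x))"
    have "s2 0 = s1 0" by (simp add: s2_def)
    then have r3: "runs (Assign M (Hd_exp (Tl_exp (Var 0)))) s2 (D x) s3"
      unfolding s3_def by (intro runs_Assign_le) (auto simp: s1(2) E_def enc_pair_def D_def)
    define s4 where "s4 = s3(Suc (Suc M) := eb (a0 x))"
    have "s3 0 = s1 0" by (simp add: s3_def s2_def M_def)
    moreover have le0: "cells (eb (a0 x)) \<le> K x" using le[of x 0] by simp
    ultimately have r4: "runs (Assign (Suc (Suc M)) (Tl_exp (Tl_exp (Var 0)))) s3 (D x) s4"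
      unfolding s4_def by (intro runs_Assign_le) (auto simp: s1(2) E_def enc_pair_def D_def)
    have "\<exists>s'. runs loop s4 (length (l x) * (poly P (D x) + 5 * D x) + 1) s' \<and>
        s' (Suc (Suc M)) = eb (fold (h x) (l x) (a0 x)) \<and> (\<forall>i>Suc (Suc M). s' i = s4 i)"
      unfolding loop_def D_def
    proof (rule runs_fold[where T = "poly P"])
      show "\<exists>s'. runs c s (poly P (cells (s 0))) s' \<and> s' 0 = eb (h x a acc) \<and> (\<forall>i\<ge>M. s' i = s i)"
        if "s 0 = Node (e x) (Node (ea a) (eb acc))" for a acc s
      proof -
        have s: "s 0 = e3 (x, a, acc)" using that by (simp add: e3_def enc_pair_def)
        then obtain s' where "runs c s (T3 (x, a, acc)) s'" "s' 0 = eb (h x a acc)" "\<forall>i>N. s' i = s i"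
          using c[of s "(x, a, acc)"] by auto
        moreover from this(1) have "runs c s (poly P (cells (s 0))) s'"
          by (rule runs_mono) (simp only: s P)
        ultimately show ?thesis by (auto simp: M_def Suc_le_eq)
      qed
    qed (auto simp: s4_def s3_def s2_def M_def le intro: monoI poly_nat_mono)
    then obtain s5 where s5: "runs loop s4 (length (l x) * (poly P (D x) + 5 * D x) + 1) s5"
        "s5 (Suc (Suc M)) = eb (fold (h x) (l x) (a0 x))" "\<forall>i>Suc (Suc M). s5 i = s4 i" by blast
    have r5: "runs loop s4 (B x) s5"
      using s5(1) by (rule runs_mono) (simp add: B_def length_le_cells)
    define s6 where "s6 = s5(0 := eb (fold (h x) (l x) (a0 x)))"
    have r6: "runs (Assign 0 (Var (Suc (Suc M)))) s5 (D x) s6"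
      unfolding s6_def
      by (rule runs_Assign_le) (use s5(2) le[of x "length (l x)"] in \<open>auto simp: D_def\<close>)
    have "runs (Seq c1 prog) s (T x) s6"
      unfolding prog_def T_def
      by (rule runs_Seq[OF s1(1) runs_Seq[OF r2 runs_Seq[OF r3 runs_Seq[OF r4 runs_Seq[OF r5 r6]]]]])
    moreover have "\<forall>i>max N1 (Suc (Suc M)). s6 i = s i"
      using s5(3) s1(3) by (auto simp: s6_def s4_def s3_def s2_def)
    ultimately show "\<exists>s'. runs (Seq c1 prog) s (T x) s' \<and> s' 0 = eb (fold (h x) (l x) (a0 x)) \<and>
        (\<forall>i>max N1 (Suc (Suc M)). s' i = s i)"
      by (intro exI[of _ s6]) (simp add: s6_def)
  qed
qed


section \<open>List operations obtained from folds\<close>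

lemma ptime_Cons:
  assumes "ptime e ea f" and "ptime e (enc_list ea) g"
  shows "ptime e (enc_list ea) (\<lambda>x. f x # g x)"
proof -
  have "enc_pair ea (enc_list ea) (f x, g x) = enc_list ea (f x # g x)" for x
    by (simp add: enc_pair_def)
  with ptime_Pair[OF assms] show ?thesis unfolding ptime_def by simp
qed

lemma fold_Cons_eq: "fold (#) ys zs = rev ys @ zs"
  by (induction ys arbitrary: zs) auto

lemma ptime_rev:
  assumes "ptime e (enc_list ea) l"
  shows "ptime e (enc_list ea) (\<lambda>x. rev (l x))"
proof -
  have "ptime e (enc_list ea) (\<lambda>x. fold (#) (l x) [])"
    by (rule ptime_fold[where h = "\<lambda>_. (#)", OF assms ptime_const _ ptime_size[OF assms]])
      (auto simp: fold_Cons_eq cells_enc_list_take intro!: ptime_Cons ptime_fst ptime_snd ptime_id)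
  then show ?thesis by (simp add: fold_Cons_eq)
qed

lemma ptime_append:
  assumes "ptime e (enc_list ea) f" and "ptime e (enc_list ea) g"
  shows "ptime e (enc_list ea) (\<lambda>x. f x @ g x)"
proof -
  have "ptime e (enc_list ea) (\<lambda>x. fold (#) (rev (f x)) (g x))"
    by (rule ptime_fold[where h = "\<lambda>_. (#)", OF ptime_rev[OF assms(1)] assms(2) _
          poly_bounded_add[OF ptime_size[OF assms(1)] ptime_size[OF assms(2)]]])
      (auto simp: fold_Cons_eq cells_enc_list_take intro!: ptime_Cons ptime_fst ptime_snd ptime_id
         intro: order_trans[OF cells_enc_list_take])
  then show ?thesis by (simp add: fold_Cons_eq)
qed

lemma ptime_concat:
  assumes "ptime e (enc_list (enc_list ea)) l"
  shows "ptime e (enc_list ea) (\<lambda>x. concat (l x))"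
proof -
  have *: "fold (\<lambda>l acc. acc @ l) ls acc = acc @ concat ls" for ls and acc :: "'b list"
    by (induction ls arbitrary: acc) auto
  have le: "cells (enc_list ea (concat ls)) \<le> cells (enc_list (enc_list ea) ls)" for ls
    by (induction ls) auto
  have "ptime e (enc_list ea) (\<lambda>x. fold (\<lambda>l acc. acc @ l) (l x) [])"
    by (rule ptime_fold[where h = "\<lambda>_ l acc. acc @ l", OF assms ptime_const _ ptime_size[OF assms]])
      (auto simp: * intro!: ptime_append ptime_fst ptime_snd ptime_id
         intro: order_trans[OF le cells_enc_list_take])
  then show ?thesis by (simp add: *)
qed

lemma ptime_map:
  assumes l: "ptime e (enc_list ea) l" and h: "ptime (enc_pair e ea) eb (\<lambda>p. h (fst p) (snd p))"
  shows "ptime e (enc_list eb) (\<lambda>x. map (h x) (l x))"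
proof -
  have *: "fold (\<lambda>a acc. acc @ [h x a]) ys acc = acc @ map (h x) ys" for x ys acc
    by (induction ys arbitrary: acc) auto
  obtain P where P: "\<And>x a. cells (eb (h x a)) \<le> poly P (cells (enc_pair e ea (x, a)))"
    using ptime_size[OF h] unfolding poly_bounded_def by (metis fst_conv snd_conv)
  \<comment> \<open>An entry is no larger than its list, so \<open>D x\<close> bounds the size of
    every image \<open>h x a\<close>.\<close>
  define D where "D = (\<lambda>x. poly P (Suc (cells (e x) + cells (enc_list ea (l x)))))"
  have le: "cells (enc_list eb (map (h x) (take k (l x)))) \<le>
      cells (enc_list ea (l x)) * Suc (D x)" for x k
  proof -
    have "cells (eb (h x a)) \<le> D x" if "a \<in> set (l x)" for a
      unfolding D_def using cells_le_cells_enc_list[OF that, of ea]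
      by (intro order_trans[OF P] poly_nat_mono) simp
    then have "(\<Sum>a\<leftarrow>take k (l x). Suc (cells (eb (h x a)))) \<le> (\<Sum>a\<leftarrow>take k (l x). Suc (D x))"
      by (intro sum_list_mono) (auto dest: in_set_takeD)
    also have "\<dots> \<le> length (l x) * Suc (D x)"
      by (simp only: sum_list_triv length_take of_nat_id mult_le_mono1 min.cobounded1)
    also have "\<dots> \<le> cells (enc_list ea (l x)) * Suc (D x)"
      by (intro mult_le_mono1 length_le_cells)
    finally show ?thesis by (simp add: cells_enc_list o_def)
  qed
  have "ptime e (enc_list eb) (\<lambda>x. fold (\<lambda>a acc. acc @ [h x a]) (l x) [])"
  proof (rule ptime_fold[where h = "\<lambda>x a acc. acc @ [h x a]", OF l ptime_const])
    show "ptime (enc_pair e (enc_pair ea (enc_list eb))) (enc_list eb)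
        (\<lambda>p. snd (snd p) @ [h (fst p) (fst (snd p))])"
      by (intro ptime_append ptime_Cons ptime_const ptime_comp2[OF h])
        (rule ptime_var)+
    show "poly_bounded e (\<lambda>x. cells (enc_list ea (l x)) * Suc (D x))"
      unfolding D_def by (intro poly_bounded_intros ptime_size[OF l])
  qed (use le in \<open>simp add: *\<close>)
  then show ?thesis by (simp add: *)
qed

lemma ptime_filter:
  assumes l: "ptime e (enc_list ea) l" and P: "ptime (enc_pair e ea) enc_bool (\<lambda>p. P (fst p) (snd p))"
  shows "ptime e (enc_list ea) (\<lambda>x. filter (P x) (l x))"
proof -
  have "filter (P x) ys = concat (map (\<lambda>a. if P x a then [a] else []) ys)" for x ys
    by (induction ys) auto
  moreover have "ptime e (enc_list ea) (\<lambda>x. concat (map (\<lambda>a. if P x a then [a] else []) (l x)))"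
    by (intro ptime_concat ptime_map[OF l] ptime_if[OF P] ptime_Cons ptime_const
        ptime_snd[OF ptime_id])
  ultimately show ?thesis by simp
qed

section \<open>Connectives, bounded quantifiers and equality tests\<close>

lemma ptime_not: "ptime e enc_bool f \<Longrightarrow> ptime e enc_bool (\<lambda>x. \<not> f x)"
  using ptime_if[OF _ ptime_const[of _ _ False] ptime_const[of _ _ True]]
  by (rule back_subst[where P = "ptime e enc_bool"]) auto

lemma ptime_conj:
  assumes "ptime e enc_bool f" and "ptime e enc_bool g"
  shows "ptime e enc_bool (\<lambda>x. f x \<and> g x)"
  using ptime_if[OF assms ptime_const[of _ _ False]]
  by (rule back_subst[where P = "ptime e enc_bool"]) auto

lemma ptime_disj:
  assumes "ptime e enc_bool f" and "ptime e enc_bool g"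
  shows "ptime e enc_bool (\<lambda>x. f x \<or> g x)"
  using ptime_if[OF assms(1) ptime_const[of _ _ True] assms(2)]
  by (rule back_subst[where P = "ptime e enc_bool"]) auto

lemma ptime_null:
  assumes "ptime e (enc_list ea) l"
  shows "ptime e enc_bool (\<lambda>x. l x = [])"
  using ptime_case_list[OF assms ptime_const[of _ _ True] ptime_const[of _ _ False]]
  by (rule back_subst[where P = "ptime e enc_bool"]) (auto simp: fun_eq_iff list.case_eq_if)

lemma ptime_Bex:
  assumes l: "ptime e (enc_list ea) l" and P: "ptime (enc_pair e ea) enc_bool (\<lambda>p. P (fst p) (snd p))"
  shows "ptime e enc_bool (\<lambda>x. \<exists>a\<in>set (l x). P x a)"
  using ptime_not[OF ptime_null[OF ptime_filter[OF assms]]]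
  by (rule back_subst[where P = "ptime e enc_bool"]) (auto simp: filter_empty_conv)

lemma ptime_Ball:
  assumes l: "ptime e (enc_list ea) l" and P: "ptime (enc_pair e ea) enc_bool (\<lambda>p. P (fst p) (snd p))"
  shows "ptime e enc_bool (\<lambda>x. \<forall>a\<in>set (l x). P x a)"
  using ptime_not[OF ptime_Bex[OF l ptime_not[OF P]]] by simp

text \<open>The language has no test for equality, so decidability of equality in polynomial time is
  a premise, established separately for each encoding.\<close>

lemma ptime_eq:
  assumes "ptime e ea f" and "ptime e ea g"
    and "ptime (enc_pair ea ea) enc_bool (\<lambda>p. fst p = snd p)"
  shows "ptime e enc_bool (\<lambda>x. f x = g x)"
  using assms(3,1,2) by (rule ptime_comp2)

lemma ptime_eq_bool: "ptime (enc_pair enc_bool enc_bool) enc_bool (\<lambda>p. fst p = snd p)"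
proof -
  have "ptime (enc_pair enc_bool enc_bool) enc_bool
      (\<lambda>p. (fst p \<and> snd p) \<or> (\<not> fst p \<and> \<not> snd p))"
    by (intro ptime_disj ptime_conj ptime_not ptime_fst[OF ptime_id] ptime_snd[OF ptime_id])
  then show ?thesis by (rule back_subst[where P = "ptime _ enc_bool"]) auto
qed

lemma ptime_eq_Pair:
  assumes "ptime (enc_pair e1 e1) enc_bool (\<lambda>p. fst p = snd p)"
    and "ptime (enc_pair e2 e2) enc_bool (\<lambda>p. fst p = snd p)"
  shows "ptime (enc_pair (enc_pair e1 e2) (enc_pair e1 e2)) enc_bool (\<lambda>p. fst p = snd p)"
  unfolding prod_eq_iff
  by (intro ptime_conj ptime_eq[OF _ _ assms(1)] ptime_eq[OF _ _ assms(2)])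
    (rule ptime_var)+

text \<open>A fold over the first list consumes the second one and keeps a flag that all entries
  have matched so far. The lists are equal iff the flag survives and nothing of the second list is
  left.\<close>

lemma ptime_eq_list:
  assumes "ptime (enc_pair ea ea) enc_bool (\<lambda>p. fst p = snd p)"
  shows "ptime (enc_pair (enc_list ea) (enc_list ea)) enc_bool (\<lambda>p. fst p = snd p)"
proof -
  define h where "h = (\<lambda>(a :: 'a) acc. case fst acc of [] \<Rightarrow> ([], False)
    | b # bs \<Rightarrow> (bs, snd acc \<and> a = b))"
  let ?E = "enc_pair (enc_list ea) (enc_list ea)" and ?F = "enc_pair (enc_list ea) enc_bool"
  \<comment> \<open>A mismatch, or a second list that ends too early, is never forgotten.\<close>
  have False_fix: "\<not> snd (fold h xs (ys, False))" for xs ys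
    by (induction xs arbitrary: ys) (auto simp: h_def split: list.split)
  have eq: "(snd (fold h xs (ys, True)) \<and> fst (fold h xs (ys, True)) = []) \<longleftrightarrow> xs = ys" for xs ys
  proof (induction xs arbitrary: ys)
    case (Cons a xs)
    show ?case
      by (cases ys; cases "a = hd ys") (use Cons False_fix in \<open>auto simp: h_def\<close>)
  qed auto
  \<comment> \<open>The list component only shrinks; the \<open>2\<close> accounts for the pairing
    node and the flag.\<close>
  have le: "cells (?F (fold h xs acc)) \<le> cells (enc_list ea (fst acc)) + 2" for xs acc
  proof (induction xs arbitrary: acc)
    case (Cons a xs)
    have "cells (enc_list ea (fst (h a acc))) \<le> cells (enc_list ea (fst acc))"
      by (simp add: h_def split: list.split)
    with Cons[of "h a acc"] show ?case by simp
  qed (simp add: enc_bool_def)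
  have fold: "ptime ?E ?F (\<lambda>p. fold h (fst p) (snd p, True))"
  proof (rule ptime_fold[where h = "\<lambda>_. h" and ea = ea])
    show "ptime (enc_pair ?E (enc_pair ea ?F)) ?F (\<lambda>p. h (fst (snd p)) (snd (snd p)))"
      unfolding h_def
      by (intro ptime_case_list[where ea = ea] ptime_Pair ptime_const ptime_conj ptime_eq[OF _ _ assms])
        (rule ptime_var)+
    show "poly_bounded ?E (\<lambda>p. cells (enc_list ea (snd p)) + 2)"
      by (intro poly_bounded_intros ptime_size[OF ptime_snd[OF ptime_id]])
    show "cells (?F (fold h (take k (fst p)) (snd p, True))) \<le> cells (enc_list ea (snd p)) + 2" for p k
      using le[of "take k (fst p)" "(snd p, True)"] by simp
  qed (intro ptime_Pair ptime_const ptime_fst[OF ptime_id] ptime_snd[OF ptime_id])+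
  show ?thesis
    using ptime_conj[OF ptime_snd[OF fold] ptime_null[OF ptime_fst[OF fold]]] by (simp only: eq)
qed

lemma ptime_member:
  assumes "ptime e ea f" and "ptime e (enc_list ea) l"
    and "ptime (enc_pair ea ea) enc_bool (\<lambda>p. fst p = snd p)"
  shows "ptime e enc_bool (\<lambda>x. f x \<in> set (l x))"
proof -
  have "ptime e enc_bool (\<lambda>x. \<exists>a\<in>set (l x). a = f x)"
    by (intro ptime_Bex[OF assms(2)] ptime_eq[OF _ _ assms(3)] ptime_snd[OF ptime_id]
        ptime_comp[OF assms(1)] ptime_fst[OF ptime_id])
  then show ?thesis by (rule back_subst[where P = "ptime _ enc_bool"]) auto
qed

lemma ptime_union:
  assumes "ptime e (enc_list ea) f" and "ptime e (enc_list ea) g"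
    and "ptime (enc_pair ea ea) enc_bool (\<lambda>p. fst p = snd p)"
  shows "ptime e (enc_list ea) (\<lambda>x. List.union (f x) (g x))"
  unfolding List.union_def List.insert_def
proof (rule ptime_fold[where h = "\<lambda>_ a acc. if a \<in> set acc then acc else a # acc", OF assms(1,2)])
  have "cells (enc_list ea (fold (\<lambda>a acc. if a \<in> set acc then acc else a # acc) ys acc)) \<le>
      cells (enc_list ea ys) + cells (enc_list ea acc)" for ys acc
  proof (induction ys arbitrary: acc)
    case (Cons a ys)
    show ?case using Cons[of acc] Cons[of "a # acc"] by simp
  qed simp
  then show "cells (enc_list ea (fold (\<lambda>a acc. if a \<in> set acc then acc else a # acc) (take k (f x)) (g x)))
      \<le> cells (enc_list ea (f x)) + cells (enc_list ea (g x))" for x k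
    by (rule order_trans) (simp add: cells_enc_list_take)
  show "poly_bounded e (\<lambda>x. cells (enc_list ea (f x)) + cells (enc_list ea (g x)))"
    by (intro poly_bounded_add ptime_size[OF assms(1)] ptime_size[OF assms(2)])
  show "ptime (enc_pair e (enc_pair ea (enc_list ea))) (enc_list ea)
     (\<lambda>p. if fst (snd p) \<in> set (snd (snd p)) then snd (snd p) else fst (snd p) # snd (snd p))"
    by (intro ptime_if ptime_member[OF _ _ assms(3)] ptime_Cons) (rule ptime_var)+
qed

section \<open>Arithmetic on unary numbers\<close>

lemma enc_nat_eq: "enc_nat k = enc_list (\<lambda>_. Leaf) (replicate k ())"
proof -
  have "enc_list (\<lambda>_. t) l = enc_list (\<lambda>_. t) (replicate (length l) ())" for t and l :: "'a list"
    by (induction l) auto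
  from this[of Leaf "[0..<k]"] show ?thesis by (simp add: enc_nat_def)
qed

lemma cells_enc_nat [simp]: "cells (enc_nat k) = k"
  by (simp add: enc_nat_eq cells_enc_list sum_list_replicate)

text \<open>A number has the same code as a list of units, so the results on lists apply to numbers
  and a fold can count.\<close>

lemma ptime_replicate:
  "ptime e enc_nat f \<longleftrightarrow> ptime e (enc_list (\<lambda>_. Leaf)) (\<lambda>x. replicate (f x) ())"
  unfolding ptime_def enc_nat_eq ..

lemma ptime_Suc: "ptime e enc_nat f \<Longrightarrow> ptime e enc_nat (\<lambda>x. Suc (f x))"
  unfolding ptime_replicate replicate_Suc by (intro ptime_Cons ptime_const)

lemma ptime_eq_nat: "ptime (enc_pair enc_nat enc_nat) enc_bool (\<lambda>p. fst p = snd p)"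
proof -
  have unit: "ptime (enc_pair e e) enc_bool (\<lambda>p. fst p = snd p)" for e :: "unit \<Rightarrow> tree"
    using ptime_const[of "enc_pair e e" enc_bool True] by simp
  have "ptime (enc_pair enc_nat enc_nat) enc_bool (\<lambda>p. replicate (fst p) () = replicate (snd p) ())"
    by (intro ptime_eq[OF _ _ ptime_eq_list[OF unit]])
      (rule ptime_replicate[THEN iffD1] ptime_var)+
  then show ?thesis by simp
qed

lemma ptime_upt:
  assumes "ptime e enc_nat f"
  shows "ptime e (enc_list enc_nat) (\<lambda>x. [0..<f x])"
proof -
  \<comment> \<open>Shifting \<open>[0..<k]\<close> by one and prepending \<open>0\<close> gives
    \<open>[0..<Suc k]\<close>.\<close>
  have *: "fold (\<lambda>_ acc. 0 # map Suc acc) (replicate n ()) [] = [0..<n]" for n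
  proof -
    have "fold (\<lambda>_ acc. 0 # map Suc acc) (replicate n ()) [0..<k] = [0..<n + k]" for k
    proof (induction n arbitrary: k)
      case (Suc n)
      from Suc[of "Suc k"] show ?case
        by (simp add: map_Suc_upt upt_conv_Cons[of 0 "Suc k", symmetric] del: upt_Suc)
    qed simp
    from this[of 0] show ?thesis by simp
  qed
  have "ptime e (enc_list enc_nat) (\<lambda>x. fold (\<lambda>_ acc. 0 # map Suc acc) (replicate (f x) ()) [])"
  proof (rule ptime_fold[where h = "\<lambda>_ _ acc. 0 # map Suc acc", OF
        ptime_replicate[THEN iffD1, OF assms] ptime_const])
    show "ptime (enc_pair e (enc_pair (\<lambda>_. Leaf) (enc_list enc_nat))) (enc_list enc_nat)
        (\<lambda>p. 0 # map Suc (snd (snd p)))"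
      by (intro ptime_Cons ptime_const ptime_map[where h = "\<lambda>_. Suc" and ea = enc_nat] ptime_Suc)
        (rule ptime_var)+
    show "poly_bounded e (\<lambda>x. cells (enc_nat (f x)) * Suc (cells (enc_nat (f x))))"
      by (intro poly_bounded_intros ptime_size[OF assms])
    fix x k
    have "cells (enc_list enc_nat [0..<n]) \<le> n * Suc n" for n
      by (induction n) auto
    then have "cells (enc_list enc_nat [0..<min k (f x)]) \<le> min k (f x) * Suc (min k (f x))" .
    also have "\<dots> \<le> f x * Suc (f x)" by (intro mult_le_mono) auto
    finally show "cells (enc_list enc_nat (fold (\<lambda>_ acc. 0 # map Suc acc) (take k (replicate (f x) ())) []))
        \<le> cells (enc_nat (f x)) * Suc (cells (enc_nat (f x)))"
      by (simp only: * take_replicate cells_enc_nat)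
  qed
  then show ?thesis by (simp only: *)
qed

lemma ptime_drop:
  assumes "ptime e enc_nat f" and "ptime e (enc_list ea) l"
  shows "ptime e (enc_list ea) (\<lambda>x. drop (f x) (l x))"
proof -
  define h where "h = (\<lambda>_ :: unit. case_list [] (\<lambda>(_ :: 'b) zs. zs))"
  have *: "fold h (replicate n ()) ys = drop n ys" for n ys
    by (induction n arbitrary: ys) (auto simp: h_def split: list.split)
  have "ptime e (enc_list ea) (\<lambda>x. fold h (replicate (f x) ()) (l x))"
  proof (rule ptime_fold[where h = "\<lambda>_. h", OF ptime_replicate[THEN iffD1, OF assms(1)] assms(2)
        _ ptime_size[OF assms(2)]])
    show "ptime (enc_pair e (enc_pair (\<lambda>_. Leaf) (enc_list ea))) (enc_list ea)
        (\<lambda>p. h (fst (snd p)) (snd (snd p)))"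
      unfolding h_def
      by (intro ptime_case_list[where ea = ea] ptime_const) (rule ptime_var)+
    show "cells (enc_list ea (fold h (take k (replicate (f x) ())) (l x))) \<le> cells (enc_list ea (l x))" for x k
      by (simp only: * take_replicate cells_enc_list_drop)
  qed
  then show ?thesis by (simp only: *)
qed

section \<open>Binary aggregators as closed sets of an implication graph\<close>

text \<open>Equal arguments are left out because conservativity already determines the value
  there.\<close>

definition vertices :: "nat \<Rightarrow> 'a list set \<Rightarrow> (nat \<times> 'a \<times> 'a) set" where
  "vertices m X = {(j, u, v). j < m \<and> u \<in> proj X j \<and> v \<in> proj X j \<and> u \<noteq> v}"

definition between :: "nat \<Rightarrow> 'a list \<Rightarrow> 'a list \<Rightarrow> 'a list \<Rightarrow> bool" where
  "between m x y w \<longleftrightarrow> (\<forall>j<m. w ! j = x ! j \<or> w ! j = y ! j)"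

text \<open>Given \<open>x\<close> and \<open>y\<close>, an aggregator picks \<open>w\<close> between them. If no such \<open>w\<close> takes its value
  at \<open>k\<close> from \<open>x\<close> and its value at \<open>l\<close> from \<open>y\<close>, then choosing the first argument at \<open>k\<close> forces
  choosing the first argument at \<open>l\<close>.\<close>

definition arc :: "nat \<Rightarrow> 'a list set \<Rightarrow> nat \<times> 'a \<times> 'a \<Rightarrow> nat \<times> 'a \<times> 'a \<Rightarrow> bool" where
  "arc m X a b \<longleftrightarrow> (\<exists>x\<in>X. \<exists>y\<in>X.
     x ! fst a = fst (snd a) \<and> y ! fst a = snd (snd a) \<and>
     x ! fst b = fst (snd b) \<and> y ! fst b = snd (snd b) \<and>
     \<not> (\<exists>w\<in>X. between m x y w \<and> w ! fst a = fst (snd a) \<and> w ! fst b = snd (snd b)))"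

definition closed_set :: "nat \<Rightarrow> 'a list set \<Rightarrow> (nat \<times> 'a \<times> 'a) set \<Rightarrow> bool" where
  "closed_set m X C \<longleftrightarrow> C \<subseteq> vertices m X \<and> (\<forall>a\<in>C. \<forall>b\<in>vertices m X. arc m X a b \<longrightarrow> b \<in> C)"

definition first_choices :: "nat \<Rightarrow> 'a list set \<Rightarrow> (nat \<Rightarrow> 'a list \<Rightarrow> 'a) \<Rightarrow> (nat \<times> 'a \<times> 'a) set" where
  "first_choices m X F = {(j, u, v) \<in> vertices m X. F j [u, v] = u}"

text \<open>This inverts the passage to first choices. On equal arguments both branches return the
  same value.\<close>

definition choice :: "(nat \<times> 'a \<times> 'a) set \<Rightarrow> nat \<Rightarrow> 'a list \<Rightarrow> 'a" where
  "choice C j as = (if (j, as ! 0, as ! 1) \<in> C then as ! 0 else as ! 1)"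

lemma nlists_2: "nlists 2 A = {[a, b] | a b. a \<in> A \<and> b \<in> A}"
  unfolding nlists_def numeral_2_eq_2 by (auto simp: length_Suc_conv)

lemma Ball_nlists_2: "(\<forall>as\<in>nlists 2 A. P as) \<longleftrightarrow> (\<forall>a\<in>A. \<forall>b\<in>A. P [a, b])"
  unfolding nlists_2 by blast

text \<open>Conservativity puts the value among the two arguments, hence into the
  projection.\<close>

lemma aggregator_2:
  "aggregator 2 m X F \<longleftrightarrow>
     (\<forall>x\<in>X. \<forall>y\<in>X. map (\<lambda>j. F j [x ! j, y ! j]) [0..<m] \<in> X) \<and>
     (\<forall>j<m. \<forall>u\<in>proj X j. \<forall>v\<in>proj X j. F j [u, v] \<in> {u, v})"
proof -
  have *: "\<forall>j<m. \<forall>u\<in>proj X j. \<forall>v\<in>proj X j. F j [u, v] \<in> proj X j"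
    if c: "\<forall>j<m. \<forall>u\<in>proj X j. \<forall>v\<in>proj X j. F j [u, v] \<in> {u, v}"
  proof (intro allI impI ballI)
    fix j u v assume "j < m" "u \<in> proj X j" "v \<in> proj X j"
    moreover from this c have "F j [u, v] \<in> {u, v}" by blast
    ultimately show "F j [u, v] \<in> proj X j" by auto
  qed
  show ?thesis
    unfolding aggregator_def Pi_iff Ball_def[symmetric] Ball_nlists_2 list.map list.set
    by (intro iffI conjI *; elim conjE; assumption)
qed

lemma dictatorial_2:
  "dictatorial 2 m X F \<longleftrightarrow>
     (\<forall>j<m. \<forall>u\<in>proj X j. \<forall>v\<in>proj X j. F j [u, v] = u) \<or>
     (\<forall>j<m. \<forall>u\<in>proj X j. \<forall>v\<in>proj X j. F j [u, v] = v)"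
proof -
  have "(\<exists>d<2. P d) \<longleftrightarrow> P 0 \<or> P (1::nat)" for P
    by (auto simp: less_2_cases_iff)
  then show ?thesis by (simp add: dictatorial_def Ball_nlists_2)
qed

lemma nth_in_proj: "x \<in> X \<Longrightarrow> x ! j \<in> proj X j"
  by (auto simp: proj_def)

text \<open>Aggregating the two evaluations that witness the arc gives a feasible \<open>w\<close>
  between them that follows the first at the source. The arc forbids \<open>w\<close> to follow the
  second at the target.\<close>

lemma closed_first_choices:
  assumes "aggregator 2 m X F"
  shows "closed_set m X (first_choices m X F)"
  unfolding closed_set_def
proof (intro conjI ballI impI)
  fix a b assume a: "a \<in> first_choices m X F" and b: "b \<in> vertices m X" and "arc m X a b"
  obtain k u u' l v v' where ab: "a = (k, u, u')" "b = (l, v, v')" by (metis surj_pair)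
  obtain x y where xy: "x \<in> X" "y \<in> X" "x ! k = u" "y ! k = u'" "x ! l = v" "y ! l = v'"
    and no: "\<And>w. w \<in> X \<Longrightarrow> between m x y w \<Longrightarrow> w ! k = u \<Longrightarrow> w ! l = v' \<Longrightarrow> False"
    using \<open>arc m X a b\<close> unfolding arc_def ab fst_conv snd_conv by blast
  define w where "w = map (\<lambda>j. F j [x ! j, y ! j]) [0..<m]"
  have "k < m" "F k [u, u'] = u" using a by (auto simp: ab first_choices_def vertices_def)
  have "l < m" using b by (simp add: ab vertices_def)
  have "w \<in> X" using assms xy(1,2) unfolding aggregator_2 w_def by blast
  moreover have "between m x y w"
    unfolding between_def
  proof (intro allI impI)
    fix j assume "j < m"
    then have "F j [x ! j, y ! j] \<in> {x ! j, y ! j}"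
      using assms nth_in_proj[OF xy(1)] nth_in_proj[OF xy(2)] unfolding aggregator_2 by blast
    with \<open>j < m\<close> show "w ! j = x ! j \<or> w ! j = y ! j" by (simp add: w_def)
  qed
  moreover have "w ! k = u" using \<open>k < m\<close> \<open>F k [u, u'] = u\<close> xy by (simp add: w_def)
  ultimately have "w ! l \<noteq> v'" using no by blast
  with \<open>between m x y w\<close> \<open>l < m\<close> xy have "F l [v, v'] = v" by (auto simp: between_def w_def)
  with b show "b \<in> first_choices m X F" by (simp add: ab first_choices_def)
qed (auto simp: first_choices_def)

text \<open>Not being the second projection puts a vertex into the set; not being the first
  projection keeps one out.\<close>

lemma first_choices_proper:
  assumes "aggregator 2 m X F" and "\<not> dictatorial 2 m X F"
  shows "first_choices m X F \<noteq> {}" and "first_choices m X F \<noteq> vertices m X"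
proof -
  have conserv: "F j [u, v] = u \<or> F j [u, v] = v" if "j < m" "u \<in> proj X j" "v \<in> proj X j" for j u v
    using assms(1) that unfolding aggregator_2 by blast
  obtain j u v where 1: "j < m" "u \<in> proj X j" "v \<in> proj X j" "F j [u, v] \<noteq> v"
    using assms(2) unfolding dictatorial_2 by blast
  then have "u \<noteq> v" "F j [u, v] = u" using conserv[OF 1(1-3)] by auto
  with 1 have "(j, u, v) \<in> first_choices m X F" by (simp add: first_choices_def vertices_def)
  then show "first_choices m X F \<noteq> {}" by blast
  obtain j u v where 2: "j < m" "u \<in> proj X j" "v \<in> proj X j" "F j [u, v] \<noteq> u"
    using assms(2) unfolding dictatorial_2 by blast
  then have "u \<noteq> v" using conserv[OF 2(1-3)] by auto
  with 2 have "(j, u, v) \<in> vertices m X - first_choices m X F"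
    by (simp add: first_choices_def vertices_def)
  then show "first_choices m X F \<noteq> vertices m X" by blast
qed

text \<open>A combination \<open>w\<close> of \<open>x\<close> and \<open>y\<close> outside \<open>X\<close> has a minimal set \<open>K\<close> of issues on which it
  agrees with no feasible evaluation between \<open>x\<close> and \<open>y\<close>. Then \<open>K\<close> contains an issue \<open>k\<close> where \<open>w\<close>
  follows only \<open>x\<close> and an issue \<open>l\<close> where it follows only \<open>y\<close>, and the feasible evaluations that
  agree with \<open>w\<close> on \<open>K\<close> without \<open>l\<close> and on \<open>K\<close> without \<open>k\<close> witness an arc that violates closedness.\<close>

lemma aggregator_choice:
  assumes X: "X \<subseteq> nlists m A" and C: "closed_set m X C"
  shows "aggregator 2 m X (choice C)"
proof -
  have "map (\<lambda>j. choice C j [x ! j, y ! j]) [0..<m] \<in> X" (is "?w \<in> X") if "x \<in> X" "y \<in> X" for x y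
  proof (rule ccontr)
    assume "?w \<notin> X"
    define w where "w = ?w"
    have wj: "w ! j = (if (j, x ! j, y ! j) \<in> C then x ! j else y ! j)" if "j < m" for j
      using that by (simp add: w_def choice_def)
    define agree where "agree K z \<longleftrightarrow> z \<in> X \<and> between m x y z \<and> (\<forall>j\<in>K. z ! j = w ! j)" for K z
    have "\<not> agree {..<m} z" for z
    proof
      assume z: "agree {..<m} z"
      then have "length z = m" using X by (auto simp: agree_def)
      with z have "z = w" by (intro nth_equalityI) (auto simp: agree_def w_def)
      with z \<open>?w \<notin> X\<close> show False by (simp add: agree_def w_def)
    qed
    then obtain K where K: "K \<subseteq> {..<m}" "\<not> (\<exists>z. agree K z)"
      and min: "\<And>K'. K' \<subset> K \<Longrightarrow> \<exists>z. agree K' z"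
    proof -
      define \<K> where "\<K> = {K \<in> Pow {..<m}. \<not> (\<exists>z. agree K z)}"
      have "finite \<K>" "\<K> \<noteq> {}"
        using \<open>\<And>z. \<not> agree {..<m} z\<close> by (auto simp: \<K>_def)
      then obtain K where "K \<in> \<K>" "\<And>K'. K' \<in> \<K> \<Longrightarrow> K' \<subseteq> K \<Longrightarrow> K = K'"
        using finite_has_minimal[of \<K>] by blast
      then show ?thesis by (intro that[of K]) (auto simp: \<K>_def)
    qed
    \<comment> \<open>Both \<open>x\<close> and \<open>y\<close> are feasible and between
      themselves, so neither agrees with \<open>w\<close> on all of \<open>K\<close>. This supplies
      \<open>l\<close> and \<open>k\<close>.\<close>
    have "between m x y x" "between m x y y" by (auto simp: between_def)
    then have "\<not> (\<forall>j\<in>K. x ! j = w ! j)" "\<not> (\<forall>j\<in>K. y ! j = w ! j)"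
      using K(2) that unfolding agree_def by blast+
    then obtain k l where kl: "k \<in> K" "y ! k \<noteq> w ! k" "l \<in> K" "x ! l \<noteq> w ! l" by blast
    with K(1) have "k < m" "l < m" by auto
    have wk: "w ! k = x ! k" "(k, x ! k, y ! k) \<in> C" and wl: "w ! l = y ! l" "(l, x ! l, y ! l) \<notin> C"
      using wj[OF \<open>k < m\<close>] wj[OF \<open>l < m\<close>] kl by (auto split: if_splits)
    obtain z where z: "agree (K - {l}) z" using min[of "K - {l}"] kl by blast
    obtain y' where y': "agree (K - {k}) y'" using min[of "K - {k}"] kl by blast
    have "z ! l \<noteq> w ! l" "y' ! k \<noteq> w ! k"
      using K(2) z y' unfolding agree_def by blast+
    then have nth: "z ! l = x ! l" "y' ! k = y ! k" "z ! k = x ! k" "y' ! l = y ! l"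
    proof -
      have "k \<noteq> l" using kl wl by auto
      have "z ! l = x ! l \<or> z ! l = y ! l" "y' ! k = x ! k \<or> y' ! k = y ! k"
        using z y' \<open>k < m\<close> \<open>l < m\<close> by (auto simp: agree_def between_def)
      then show "z ! l = x ! l" "y' ! k = y ! k"
        using \<open>z ! l \<noteq> w ! l\<close> \<open>y' ! k \<noteq> w ! k\<close> wk(1) wl(1) by auto
      show "z ! k = x ! k" "y' ! l = y ! l"
        using z y' kl wk(1) wl(1) \<open>k \<noteq> l\<close> unfolding agree_def by auto
    qed
    \<comment> \<open>Such a \<open>v\<close> would agree with \<open>w\<close> on all of
      \<open>K\<close>: at \<open>k\<close> and \<open>l\<close> by assumption, and elsewhere in
      \<open>K\<close> because \<open>z\<close> and \<open>y'\<close> both agree with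
      \<open>w\<close> there.\<close>
    have no: False if v: "v \<in> X" "between m z y' v" "v ! k = x ! k" "v ! l = y ! l" for v
    proof -
      have "between m x y v"
        unfolding between_def
      proof (intro allI impI)
        fix j assume "j < m"
        then have "v ! j = z ! j \<or> v ! j = y' ! j" "z ! j = x ! j \<or> z ! j = y ! j"
          "y' ! j = x ! j \<or> y' ! j = y ! j"
          using v(2) z y' unfolding agree_def between_def by blast+
        then show "v ! j = x ! j \<or> v ! j = y ! j" by auto
      qed
      moreover have "v ! j = w ! j" if "j \<in> K" for j
      proof (cases "j = k \<or> j = l")
        case True
        then show ?thesis using v(3,4) wk(1) wl(1) by auto
      next
        case False
        have "j < m" using that K(1) by auto
        then have "v ! j = z ! j \<or> v ! j = y' ! j" using v(2) by (simp add: between_def)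
        moreover have "z ! j = w ! j" "y' ! j = w ! j"
          using False that z y' unfolding agree_def by blast+
        ultimately show ?thesis by auto
      qed
      ultimately show False using K(2) v(1) unfolding agree_def by blast
    qed
    have "arc m X (k, x ! k, y ! k) (l, x ! l, y ! l)"
      unfolding arc_def fst_conv snd_conv using z y' nth no unfolding agree_def by blast
    moreover have "(l, x ! l, y ! l) \<in> vertices m X"
      using \<open>l < m\<close> that kl wl by (auto simp: vertices_def nth_in_proj)
    ultimately show False using C wk wl unfolding closed_set_def by blast
  qed
  then show ?thesis unfolding aggregator_2 by (auto simp: choice_def)
qed

lemma nondictatorial_choice:
  assumes "C \<subseteq> vertices m X" and "C \<noteq> {}" and "C \<noteq> vertices m X"
  shows "\<not> dictatorial 2 m X (choice C)"
proof -
  obtain j u v where C: "(j, u, v) \<in> C" "(j, u, v) \<in> vertices m X" using assms by auto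
  obtain k u' v' where C': "(k, u', v') \<notin> C" "(k, u', v') \<in> vertices m X" using assms by auto
  have "choice C j [u, v] \<noteq> v" "choice C k [u', v'] \<noteq> u'"
    using C C' by (auto simp: choice_def vertices_def)
  then show ?thesis
    using C(2) C'(2) unfolding dictatorial_2 vertices_def by blast
qed


section \<open>The algorithm\<close>

text \<open>Unlike \<open>!\<close>, whose value at an index that is too large is unspecified, this is computable on
  all inputs.\<close>

definition ith :: "position list \<Rightarrow> nat \<Rightarrow> position" where
  "ith x j = (case drop j x of [] \<Rightarrow> [] | a # _ \<Rightarrow> a)"

type_synonym vertex = "nat \<times> position \<times> position"

text \<open>Repetitions are harmless: the list has to contain all vertices and to be at least as
  long as their number.\<close>

definition vertex_list :: "nat \<Rightarrow> position list list \<Rightarrow> vertex list" where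
  "vertex_list m xs = concat (map (\<lambda>j. concat (map (\<lambda>x. concat (map (\<lambda>y.
     if ith x j = ith y j then [] else [(j, ith x j, ith y j)]) xs)) xs)) [0..<m])"

text \<open>All quantifiers range over sets of explicit lists, so that each becomes a search through
  a list.\<close>

definition arc_test :: "nat \<Rightarrow> position list list \<Rightarrow> vertex \<Rightarrow> vertex \<Rightarrow> bool" where
  "arc_test m xs a b \<longleftrightarrow> (\<exists>x\<in>set xs. \<exists>y\<in>set xs.
     ith x (fst a) = fst (snd a) \<and> ith y (fst a) = snd (snd a) \<and>
     ith x (fst b) = fst (snd b) \<and> ith y (fst b) = snd (snd b) \<and>
     \<not> (\<exists>w\<in>set xs. (\<forall>j\<in>set [0..<m]. ith w j = ith x j \<or> ith w j = ith y j) \<and>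
          ith w (fst a) = fst (snd a) \<and> ith w (fst b) = snd (snd b)))"

text \<open>Filtering the vertex list, rather than appending new vertices, keeps the result no
  larger than that list under iteration.\<close>

definition step :: "nat \<Rightarrow> position list list \<Rightarrow> vertex list \<Rightarrow> vertex list" where
  "step m xs S = filter (\<lambda>b. b \<in> set S \<or> (\<exists>a\<in>set S. arc_test m xs a b)) (vertex_list m xs)"

text \<open>The vertex list serves as a clock: one step per entry is enough to reach a fixed
  point.\<close>

definition reach :: "nat \<Rightarrow> position list list \<Rightarrow> vertex \<Rightarrow> vertex list" where
  "reach m xs v = fold (\<lambda>_. step m xs) (vertex_list m xs) [v]"

text \<open>\<open>List.union\<close> with the empty list removes repeated values, so that each pair
  of arguments gets exactly one entry.\<close>

definition table :: "nat \<Rightarrow> position list list \<Rightarrow> vertex list \<Rightarrow> nat \<Rightarrow> (position list \<times> position) list" where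
  "table m xs S j = concat (map (\<lambda>a. map (\<lambda>b. ([a, b], if (j, a, b) \<in> set S then a else b))
     (List.union (map (\<lambda>x. ith x j) xs) [])) (List.union (map (\<lambda>x. ith x j) xs) []))"

text \<open>An empty filter result means that the implication graph is strongly connected.\<close>

definition solve :: "nat \<Rightarrow> position list list \<Rightarrow> tree" where
  "solve m xs =
     (case filter (\<lambda>v. \<exists>w\<in>set (vertex_list m xs). w \<notin> set (reach m xs v)) (vertex_list m xs) of
        [] \<Rightarrow> Leaf
      | v # _ \<Rightarrow> Node Leaf (enc_tables (map (table m xs (reach m xs v)) [0..<m])))"

section \<open>Correctness of the algorithm\<close>

lemma ith_nth: "j < length x \<Longrightarrow> ith x j = x ! j"
  unfolding ith_def by (subst Cons_nth_drop_Suc[symmetric]) auto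

context
  fixes m :: nat and A :: "position set" and X xs
  assumes X: "X \<subseteq> nlists m A" and xs: "set xs = X"
begin

lemma ith_row:
  assumes "x \<in> set xs" and "j < m"
  shows "ith x j = x ! j"
proof -
  have "x \<in> nlists m A" using assms(1) X xs by blast
  then have "length x = m" by (rule nlistsE_length)
  with assms(2) show ?thesis by (simp add: ith_nth)
qed

lemma set_vertex_list: "set (vertex_list m xs) = vertices m X"
proof -
  have "set (vertex_list m xs) =
      (\<Union>j<m. \<Union>x\<in>set xs. \<Union>y\<in>set xs. if ith x j = ith y j then {} else {(j, ith x j, ith y j)})"
    by (simp add: vertex_list_def if_distrib[of set] lessThan_atLeast0 cong: if_cong)
  also have "\<dots> = (\<Union>j<m. \<Union>x\<in>X. \<Union>y\<in>X. if x ! j = y ! j then {} else {(j, x ! j, y ! j)})"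
    unfolding xs[symmetric] by (intro SUP_cong refl) (simp add: ith_row)
  also have "\<dots> = vertices m X"
    by (auto simp: vertices_def proj_def split: if_splits)
  finally show ?thesis .
qed

lemma arc_test: "a \<in> vertices m X \<Longrightarrow> b \<in> vertices m X \<Longrightarrow> arc_test m xs a b \<longleftrightarrow> arc m X a b"
proof -
  assume "a \<in> vertices m X" "b \<in> vertices m X"
  then have "fst a < m" "fst b < m" by (auto simp: vertices_def)
  moreover have "(\<forall>j\<in>set [0..<m]. ith w j = ith x j \<or> ith w j = ith y j) \<longleftrightarrow> between m x y w"
    if "w \<in> set xs" "x \<in> set xs" "y \<in> set xs" for w x y
    using that by (auto simp: between_def ith_row)
  ultimately show ?thesis
    unfolding arc_test_def arc_def xs[symmetric]
    by (simp add: ith_row del: set_upt cong: bex_cong conj_cong)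
qed

lemma set_step:
  assumes "set S \<subseteq> vertices m X"
  shows "set (step m xs S) = {b \<in> vertices m X. b \<in> set S \<or> (\<exists>a\<in>set S. arc m X a b)}"
  unfolding step_def set_filter set_vertex_list using assms arc_test by blast

text \<open>The iterates increase, and as long as they have not become stationary the
  \<open>n\<close>-th one has more than \<open>n\<close> elements. So they are stationary after as
  many steps as the vertex list has entries. Each iterate stays inside any closed set that contains
  \<open>v\<close>, which gives leastness.\<close>

lemma
  assumes "v \<in> vertices m X"
  shows reach_self: "v \<in> set (reach m xs v)"
    and closed_reach: "closed_set m X (set (reach m xs v))"
    and reach_least: "closed_set m X C \<Longrightarrow> v \<in> C \<Longrightarrow> set (reach m xs v) \<subseteq> C"
proof -
  define S where "S = (\<lambda>n. (step m xs ^^ n) [v])"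
  have reach: "reach m xs v = S (length (vertex_list m xs))"
  proof -
    have "fold (\<lambda>_. f) l S = (f ^^ length l) S" for f and l S :: "vertex list"
      by (induction l arbitrary: S) (auto simp: funpow_swap1)
    then show ?thesis by (simp only: reach_def S_def)
  qed
  have S_Suc: "S (Suc n) = step m xs (S n)" for n by (simp add: S_def)
  have sub: "set (S n) \<subseteq> vertices m X" for n
  proof (induction n)
    case (Suc n)
    then show ?case by (auto simp: S_Suc set_step)
  qed (simp add: S_def assms)
  have incr: "set (S n) \<subseteq> set (S (Suc n))" for n
    using sub[of n] by (auto simp: S_Suc set_step)
  have fin: "finite (vertices m X)" by (simp add: set_vertex_list[symmetric])
  have grow: "set (S n) = set (S (Suc n)) \<or> n < card (set (S n))" for n
  proof (induction n)
    case 0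
    show ?case by (simp add: S_def)
  next
    case (Suc n)
    show ?case
    proof (cases "set (S n) = set (S (Suc n))")
      case True
      \<comment> \<open>A step depends on its argument only through the set of its entries, so
        equality of sets propagates.\<close>
      have "set (step m xs (S n)) = set (step m xs (S (Suc n)))"
        by (simp only: step_def True)
      from this[folded S_Suc] show ?thesis ..
    next
      case False
      with incr[of n] have "card (set (S n)) < card (set (S (Suc n)))"
        by (intro psubset_card_mono) auto
      with Suc False show ?thesis by simp
    qed
  qed
  let ?n = "length (vertex_list m xs)"
  have "card (set (S ?n)) \<le> ?n"
    using card_mono[OF fin sub[of ?n]] card_length[of "vertex_list m xs"]
    by (simp add: set_vertex_list)
  with grow[of ?n] have "set (S (Suc ?n)) = set (S ?n)" by auto
  then have "set (step m xs (S ?n)) = set (S ?n)" by (simp only: S_Suc)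
  then show "closed_set m X (set (reach m xs v))"
    using sub[of ?n] by (auto simp: reach closed_set_def set_step)
  have "v \<in> set (S n)" for n
  proof (induction n)
    case (Suc n)
    then show ?case using incr by blast
  qed (simp add: S_def)
  then show "v \<in> set (reach m xs v)" by (simp add: reach)
  show "set (reach m xs v) \<subseteq> C" if "closed_set m X C" "v \<in> C"
  proof -
    have "set (S n) \<subseteq> C" for n
    proof (induction n)
      case (Suc n)
      with that show ?case unfolding S_Suc set_step[OF sub] closed_set_def by blast
    qed (simp add: S_def that)
    then show ?thesis by (simp add: reach)
  qed
qed

lemma tables_choice: "tables 2 m X (choice (set S)) (map (table m xs S) [0..<m])"
proof -
  have "listing (table m xs S j) ((\<lambda>as. (as, choice (set S) j as)) ` nlists 2 (proj X j))"
    if "j < m" for j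
  proof -
    define D where "D = List.union (map (\<lambda>x. ith x j) xs) []"
    have D: "distinct D" "set D = proj X j"
      using that xs by (auto simp: D_def proj_def ith_row)
    have t: "table m xs S j =
        concat (map (\<lambda>a. map (\<lambda>b. ([a, b], if (j, a, b) \<in> set S then a else b)) D) D)"
      by (simp add: table_def D_def)
    \<comment> \<open>The argument lists alone are distinct, as they enumerate the product of a
      distinct list with itself.\<close>
    have "map fst (table m xs S j) = concat (map (\<lambda>a. map (\<lambda>b. [a, b]) D) D)"
      by (simp add: t map_concat o_def)
    also have "\<dots> = map (\<lambda>(a, b). [a, b]) (List.product D D)"
      by (simp add: product_concat_map map_concat o_def)
    finally have "distinct (map fst (table m xs S j))"
      using D(1) by (simp add: distinct_map distinct_product inj_on_def)
    then have "distinct (table m xs S j)" by (simp add: distinct_map)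
    moreover have "set (table m xs S j) = (\<lambda>as. (as, choice (set S) j as)) ` nlists 2 (proj X j)"
      using D(2) by (auto simp: t nlists_2 choice_def image_iff)
    ultimately show ?thesis by (simp add: listing_def)
  qed
  then show ?thesis by (simp add: tables_def)
qed

lemma nondictatorial_reach:
  assumes "v \<in> vertices m X" and "set (reach m xs v) \<noteq> vertices m X"
  shows "non_dictatorial_aggregator 2 m X (choice (set (reach m xs v)))"
  unfolding non_dictatorial_aggregator_def
proof
  have "set (reach m xs v) \<subseteq> vertices m X"
    using closed_reach[OF assms(1)] unfolding closed_set_def by blast
  moreover have "set (reach m xs v) \<noteq> {}" using reach_self[OF assms(1)] by auto
  ultimately show "\<not> dictatorial 2 m X (choice (set (reach m xs v)))"
    using assms(2) by (rule nondictatorial_choice)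
qed (rule aggregator_choice[OF X closed_reach[OF assms(1)]])

lemma correct_solve: "correct_output m X (solve m xs)"
proof (cases "\<exists>F. non_dictatorial_aggregator 2 m X F")
  case True
  then obtain F where F: "aggregator 2 m X F" "\<not> dictatorial 2 m X F"
    unfolding non_dictatorial_aggregator_def by blast
  let ?C = "first_choices m X F"
  have C: "?C \<subseteq> vertices m X" "closed_set m X ?C"
    using closed_first_choices[OF F(1)] unfolding closed_set_def by blast+
  then obtain v w where "v \<in> ?C" "v \<in> vertices m X" "w \<in> vertices m X" "w \<notin> ?C"
    using first_choices_proper[OF F] by blast
  \<comment> \<open>The closed set of a given aggregator contains everything reachable from
    \<open>v\<close>, so a vertex outside it is not reached.\<close>
  then have "\<exists>w\<in>vertices m X. w \<notin> set (reach m xs v)"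
    using reach_least C by blast
  with \<open>v \<in> vertices m X\<close>
  have "filter (\<lambda>v. \<exists>w\<in>set (vertex_list m xs). w \<notin> set (reach m xs v)) (vertex_list m xs) \<noteq> []"
    by (auto simp: filter_empty_conv set_vertex_list)
  then obtain v vs where v:
    "filter (\<lambda>v. \<exists>w\<in>set (vertex_list m xs). w \<notin> set (reach m xs v)) (vertex_list m xs) = v # vs"
    by (meson list.exhaust)
  then have "v \<in> set (filter (\<lambda>v. \<exists>w\<in>set (vertex_list m xs). w \<notin> set (reach m xs v)) (vertex_list m xs))"
    by simp
  then have V: "v \<in> vertices m X" "set (reach m xs v) \<noteq> vertices m X"
    by (auto simp: set_vertex_list)
  then have "non_dictatorial_aggregator 2 m X (choice (set (reach m xs v)))"
    by (rule nondictatorial_reach)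
  moreover have "solve m xs = Node Leaf (enc_tables (map (table m xs (reach m xs v)) [0..<m]))"
    by (simp add: solve_def v)
  ultimately show ?thesis
    unfolding correct_output_def using True tables_choice by (simp del: map_map) blast
next
  case False
  have "set (reach m xs v) = vertices m X" if "v \<in> vertices m X" for v
  proof (rule ccontr)
    assume "set (reach m xs v) \<noteq> vertices m X"
    then have "non_dictatorial_aggregator 2 m X (choice (set (reach m xs v)))"
      using that by (intro nondictatorial_reach)
    with False show False by blast
  qed
  then have "filter (\<lambda>v. \<exists>w\<in>set (vertex_list m xs). w \<notin> set (reach m xs v)) (vertex_list m xs) = []"
    by (auto simp: filter_empty_conv set_vertex_list)
  then show ?thesis using False by (simp add: correct_output_def solve_def)
qed

end

section \<open>Running time\<close>

abbreviation "enc_row \<equiv> enc_list enc_position"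
abbreviation "enc_vertex \<equiv> enc_pair enc_nat (enc_pair enc_position enc_position)"

lemma ptime_eq_position:
  assumes "ptime e enc_position f" and "ptime e enc_position g"
  shows "ptime e enc_bool (\<lambda>x. f x = g x)"
  using ptime_eq[OF assms, unfolded enc_position_def, OF ptime_eq_list[OF ptime_eq_bool]] .

lemma ptime_member_vertex:
  assumes "ptime e enc_vertex f" and "ptime e (enc_list enc_vertex) l"
  shows "ptime e enc_bool (\<lambda>x. f x \<in> set (l x))"
  by (intro ptime_member[OF assms] ptime_eq_Pair ptime_eq_nat)
    (simp_all add: enc_position_def ptime_eq_list ptime_eq_bool)

lemma ptime_ith:
  assumes "ptime e enc_row f" and "ptime e enc_nat g"
  shows "ptime e enc_position (\<lambda>x. ith (f x) (g x))"
  unfolding ith_def by (rule ptime_case_list ptime_drop ptime_const assms ptime_var)+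

text \<open>One rule for each construct in the definitions of the algorithm; bound variables appear
  as projections from nested pairs.\<close>

lemmas ptime_intros = ptime_case_list ptime_if ptime_Cons ptime_concat ptime_map ptime_filter
  ptime_Bex ptime_Ball ptime_conj ptime_disj ptime_not ptime_Pair ptime_upt ptime_ith
  ptime_eq_position ptime_member_vertex ptime_var ptime_const

lemma ptime_vertex_list:
  assumes "ptime e enc_nat f" and "ptime e (enc_list enc_row) g"
  shows "ptime e (enc_list enc_vertex) (\<lambda>x. vertex_list (f x) (g x))"
proof (rule ptime_comp2[OF _ assms])
  show "ptime (enc_pair enc_nat (enc_list enc_row)) (enc_list enc_vertex)
      (\<lambda>p. vertex_list (fst p) (snd p))"
    unfolding vertex_list_def by (rule ptime_intros)+
qed

lemma ptime_arc_test:
  assumes "ptime e enc_nat f" and "ptime e (enc_list enc_row) g"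
    and "ptime e enc_vertex a" and "ptime e enc_vertex b"
  shows "ptime e enc_bool (\<lambda>x. arc_test (f x) (g x) (a x) (b x))"
proof -
  have "ptime (enc_pair enc_nat (enc_pair (enc_list enc_row) (enc_pair enc_vertex enc_vertex))) enc_bool
      (\<lambda>p. arc_test (fst p) (fst (snd p)) (fst (snd (snd p))) (snd (snd (snd p))))"
    unfolding arc_test_def by (rule ptime_intros)+
  from ptime_comp[OF this ptime_Pair[OF assms(1) ptime_Pair[OF assms(2) ptime_Pair[OF assms(3,4)]]]]
  show ?thesis by simp
qed

lemma ptime_step:
  assumes "ptime e enc_nat f" and "ptime e (enc_list enc_row) g" and "ptime e (enc_list enc_vertex) S"
  shows "ptime e (enc_list enc_vertex) (\<lambda>x. step (f x) (g x) (S x))"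
proof (rule ptime_comp3[OF _ assms])
  show "ptime (enc_pair enc_nat (enc_pair (enc_list enc_row) (enc_list enc_vertex))) (enc_list enc_vertex)
      (\<lambda>p. step (fst p) (fst (snd p)) (snd (snd p)))"
    unfolding step_def by (rule ptime_vertex_list ptime_arc_test ptime_intros)+
qed

text \<open>Every accumulator is either the start list or the output of the last step, which is a
  filtered vertex list. Hence sizes do not build up over the iterations.\<close>

lemma ptime_reach:
  assumes "ptime e enc_nat f" and "ptime e (enc_list enc_row) g" and "ptime e enc_vertex v"
  shows "ptime e (enc_list enc_vertex) (\<lambda>x. reach (f x) (g x) (v x))"
  unfolding reach_def
proof (rule ptime_fold[where h = "\<lambda>x _. step (f x) (g x)"])
  let ?K = "\<lambda>x. cells (enc_list enc_vertex (vertex_list (f x) (g x))) + cells (enc_list enc_vertex [v x])"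
  show list: "ptime e (enc_list enc_vertex) (\<lambda>x. vertex_list (f x) (g x))"
    by (rule ptime_vertex_list[OF assms(1,2)])
  show start: "ptime e (enc_list enc_vertex) (\<lambda>x. [v x])"
    by (intro ptime_Cons ptime_const assms)
  show "poly_bounded e ?K"
    by (intro poly_bounded_add ptime_size[OF list] ptime_size[OF start])
  show "ptime (enc_pair e (enc_pair enc_vertex (enc_list enc_vertex))) (enc_list enc_vertex)
      (\<lambda>p. step (f (fst p)) (g (fst p)) (snd (snd p)))"
    by (rule ptime_step ptime_comp[OF assms(1)] ptime_comp[OF assms(2)] ptime_var)+
  have filter: "cells (enc_list ea (filter P l)) \<le> cells (enc_list ea l)"
    for P l and ea :: "'b \<Rightarrow> tree"
    by (induction l) auto
  show "cells (enc_list enc_vertex (fold (\<lambda>_. step (f x) (g x)) (take k (vertex_list (f x) (g x))) [v x]))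
      \<le> ?K x" for x k
  proof (cases "take k (vertex_list (f x) (g x))" rule: rev_cases)
    case Nil
    show ?thesis by (simp only: Nil fold.simps id_apply le_add2)
  next
    case (snoc l b)
    show ?thesis
      by (simp only: snoc fold_append fold.simps o_apply id_apply step_def trans_le_add1[OF filter])
  qed
qed

lemma ptime_table:
  assumes "ptime e enc_nat f" and "ptime e (enc_list enc_row) g" and "ptime e (enc_list enc_vertex) S"
    and "ptime e enc_nat j"
  shows "ptime e (enc_list (enc_pair enc_row enc_position)) (\<lambda>x. table (f x) (g x) (S x) (j x))"
proof -
  have union: "ptime e enc_row l \<Longrightarrow> ptime e enc_row l' \<Longrightarrow>
      ptime e enc_row (\<lambda>x. List.union (l x) (l' x))"
    for e :: "'b \<Rightarrow> tree" and l l'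
    by (rule ptime_union) (simp_all add: enc_position_def ptime_eq_list ptime_eq_bool)
  have "ptime (enc_pair enc_nat (enc_pair (enc_list enc_row) (enc_pair (enc_list enc_vertex) enc_nat)))
      (enc_list (enc_pair enc_row enc_position))
      (\<lambda>p. table (fst p) (fst (snd p)) (fst (snd (snd p))) (snd (snd (snd p))))"
    unfolding table_def by (rule union ptime_intros)+
  from ptime_comp[OF this ptime_Pair[OF assms(1) ptime_Pair[OF assms(2) ptime_Pair[OF assms(3,4)]]]]
  show ?thesis by simp
qed

text \<open>The result is itself a tree, so it is encoded by the identity.\<close>

lemma ptime_solve:
  "ptime (enc_pair enc_listing enc_nat) (\<lambda>t. t) (\<lambda>p. solve (snd p) (fst p))"
proof -
  let ?tables = "enc_list (enc_list (enc_pair enc_row enc_position))"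
  \<comment> \<open>The positive answer is a pair whose first component is the unit value encoded as
    \<open>Leaf\<close>.\<close>
  have Node: "ptime e (\<lambda>t. t) (\<lambda>x. Node Leaf (enc_tables (f x)))" if "ptime e ?tables f" for e f
  proof -
    have "enc_tables = ?tables"
      unfolding enc_tables_def by (intro arg_cong[of _ _ enc_list] ext) (simp add: enc_pair_def split_beta)
    with ptime_Pair[OF ptime_const[of e "\<lambda>_. Leaf" "()"] that] show ?thesis
      unfolding ptime_def by (simp add: enc_pair_def)
  qed
  show ?thesis
    unfolding solve_def enc_listing_def
    by (rule ptime_vertex_list ptime_reach ptime_table Node ptime_intros)+
qed

theorem theorem3p1:
  shows "\<exists>(c :: com) (p :: nat poly).
    \<forall>(A :: position set) (m :: nat) (X :: position list set) as xs.
      feasible_evaluations A m X \<longrightarrow> listing as A \<longrightarrow> listing xs X \<longrightarrow>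
      (\<exists>t result. computes_in_time c (enc_input as m xs) t result \<and>
         t \<le> poly p (cells (enc_listing xs)) \<and>
         correct_output m X result)"
proof -
  define E where "E = enc_pair enc_listing enc_nat"
  obtain c N T where T: "poly_bounded E T"
    and c: "\<And>q s. s 0 = E q \<Longrightarrow>
      \<exists>s'. runs c s (T q) s' \<and> s' 0 = solve (snd q) (fst q) \<and> (\<forall>i>N. s' i = s i)"
    by (rule ptimeE[OF ptime_solve, folded E_def]) (rule that)
  obtain P where P: "\<And>q. T q \<le> poly P (cells (E q))"
    using T unfolding poly_bounded_def by blast
  \<comment> \<open>One assignment builds the pair of \<open>xs\<close> and \<open>m\<close>. Its
    cost counts only the resulting tree, so the listing of \<open>A\<close> is discarded free of
    charge.\<close>
  define prog where
    "prog = Seq (Assign 0 (Cons_exp (Hd_exp (Var 0)) (Hd_exp (Tl_exp (Var 0))))) c"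
  \<comment> \<open>With \<open>L\<close> the size of the listing, the pair has at most
    \<open>2 * L + 1\<close> cells: the assignment costs at most \<open>2 * L + 2\<close>, and the
    rest at most \<open>P\<close> at \<open>2 * L + 1\<close>.\<close>
  define p where "p = [:2, 2:] + pcompose P [:1, 2:]"
  show ?thesis
  proof (intro exI[of _ prog] exI[of _ p] allI impI)
    fix A :: "position set" and m and X :: "position list set" and as xs
    assume feas: "feasible_evaluations A m X" and "listing xs X"
    then have X: "X \<subseteq> nlists m A" and xs: "set xs = X"
      by (auto simp: feasible_evaluations_def listing_def)
    define L where "L = cells (enc_listing xs)"
    \<comment> \<open>The projection at issue \<open>0\<close> has two elements, so \<open>X\<close>
      contains an evaluation, and its \<open>m\<close> entries are part of the listing.\<close>
    have "m \<le> L"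
    proof -
      have "card (proj X 0) \<ge> 2" using feas by (auto simp: feasible_evaluations_def)
      then obtain x where "x \<in> X" by (force simp: proj_def)
      then have "length x = m" using X by (auto dest: nlistsE_length)
      then have "m \<le> cells (enc_row x)" using length_le_cells by metis
      also have "\<dots> \<le> L"
        using \<open>x \<in> X\<close> xs unfolding L_def enc_listing_def by (intro cells_le_cells_enc_list) simp
      finally show ?thesis .
    qed
    then have size: "cells (E (xs, m)) \<le> 2 * L + 1" by (simp add: E_def L_def)
    define s where "s = (\<lambda>_ :: nat. Leaf)(0 := enc_input as m xs)"
    have "runs (Assign 0 (Cons_exp (Hd_exp (Var 0)) (Hd_exp (Tl_exp (Var 0))))) s
        (Suc (cells (E (xs, m)))) (s(0 := E (xs, m)))"
      by (rule runs_Assign_le) (simp_all add: s_def enc_input_def E_def enc_pair_def)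
    moreover obtain s' where "runs c (s(0 := E (xs, m))) (T (xs, m)) s'" and s': "s' 0 = solve m xs"
      using c[of "s(0 := E (xs, m))" "(xs, m)"] by auto
    ultimately obtain t where t: "t \<le> Suc (cells (E (xs, m))) + T (xs, m)" "exec prog s t s'"
      unfolding prog_def using runs_Seq unfolding runs_def by blast
    have "T (xs, m) \<le> poly P (2 * L + 1)"
      using P[of "(xs, m)"] poly_nat_mono[OF size] by (rule order_trans)
    then have "t \<le> poly p L"
      using t(1) size by (simp add: p_def poly_pcompose mult.commute)
    moreover have "computes_in_time prog (enc_input as m xs) t (solve m xs)"
      unfolding computes_in_time_def using t(2) s' unfolding s_def by blast
    ultimately show "\<exists>t result. computes_in_time prog (enc_input as m xs) t result \<and>
         t \<le> poly p (cells (enc_listing xs)) \<and> correct_output m X result"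
      using correct_solve[OF X xs] unfolding L_def by blast
  qed
qed

end
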